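(* Let $(X,x)$ be a pointed topological space. Then for every integer $k\ge1$: (i) If $(X,x)\in\mathrm{HPol}_*$, then $\check{\pi}_k^{top}(X,x)$ is discrete. (ii) If $\mathbf{p}:(X,x)\to(\mathbf{X},\mathbf{x})=((X_\lambda,x_\lambda),p_{\lambda\lambda'},\Lambda)$ is an $\mathrm{HPol}_*$-expansion of $(X,x)$ and $\check{\pi}_k^{top}(X,x)$ is discrete, then there is $\lambda\in\Lambda$ such that $\check{\pi}_k^{top}(X,x)\le\check{\pi}_k^{top}(X_\lambda,x_\lambda)$, i.e. $\check{\pi}_k^{top}(X,x)$ is isomorphic, as a topological group, to a subgroup of $\check{\pi}_k^{top}(X_\lambda,x_\lambda)$.
   Context: $\mathrm{HTop}_*$ is the pointed homotopy category of pointed topological spaces; $\mathrm{HPol}_*$ is its full subcategory of pointed spaces having the pointed homotopy type of a pointed polyhedron. Inverse systems are indexed by directed sets. An $\mathrm{HPol}_*$-expansion of $(X,x)$ is an inverse system $(\mathbf{X},\mathbf{x})=((X_\lambda,x_\lambda),p_{\lambda\lambda'},\Lambda)$ in $\mathrm{HPol}_*$ with a morphism $\mathbf{p}=(p_\lambda):(X,x)\to(\mathbf{X},\mathbf{x})$ of pro-$\mathrm{HTop}_*$ (so $p_{\lambda\lambda'}p_{\lambda'}=p_\lambda$ in $\mathrm{HTop}_*$) such that: (E1) for every $P\in \mathrm{HPol}_*$ and every $h:(X,x)\to P$ in $\mathrm{HTop}_*$ there are $\lambda\in\Lambda$ and $f:(X_\lambda,x_\lambda)\to P$ with $fp_\lambda=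 h$; (E2) if $f_0,f_1:(X_\lambda,x_\lambda)\to P$ satisfy $f_0p_\lambda= f_1p_\lambda$, then $f_0p_{\lambda\lambda'}= f_1p_{\lambda\lambda'}$ for some $\lambda'\ge\lambda$. Every pointed space admits such an expansion. A shape morphism $F:(S^k,* )\to(X,x)$ is, with an expansion of $(X,x)$ fixed, a family $(f_\lambda)_{\lambda\in\Lambda}$ of pointed homotopy classes $f_\lambda:(S^k,* )\to(X_\lambda,x_\lambda)$ with $p_{\lambda\lambda'}f_{\lambda'}=f_\lambda$ for $\lambda\le\lambda'$ (families for different expansions are identified via the canonical isomorphism of expansions), and $p_\lambda\circ F=f_\lambda$. The $k$th shape group $\check{\pi}_k(X,x)=Sh((S^k,* ),(X,x))$ is the set of these shape morphisms with operation $F+G$ represented by $(f_\lambda+g_\lambda)_\lambda$ (product in $\pi_k(X_\lambda,x_\lambda)$). $\check{\pi}_k^{top}(X,x)$ is this group with the topology having as basis the sets $V_\lambda^F=\{G : p_\lambda\circ F=p_\lambda\circ G \text{ as pointed homotopy classes to } X_\lambda\}$, $F\in Sh((S^k,* ),(X,x))$, $\lambda\in\Lambda$. It is a topological group and does not depend on the choice of expansion. *)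

theory Defs
  imports "HOL-Homology.Homology" "HOL-Algebra.Group"
begin

text \<open>
  HOL has no proper class of all spaces: the spaces of the categories \<open>HTop\<^sub>*\<close> and \<open>HPol\<^sub>*\<close> live on
  an arbitrary type \<open>'u\<close> serving as universe. Testing expansions only against polyhedra in \<open>'u\<close> is
  no restriction once \<open>'u\<close> has at least the cardinality of the continuum and of the spaces involved,
  since maps and homotopies into a polyhedron factor through a subcomplex of bounded size.
\<close>

type_synonym 'a ptd = "'a topology \<times> 'a"

definition ptd_space :: "'a ptd \<Rightarrow> bool" where
  "ptd_space X \<longleftrightarrow> snd X \<in> topspace (fst X)"

definition ptd_map :: "'a ptd \<Rightarrow> 'b ptd \<Rightarrow> ('a \<Rightarrow> 'b) \<Rightarrow> bool" where
  "ptd_map X Y f \<longleftrightarrow> continuous_map (fst X) (fst Y) f \<and> f (snd X) = snd Y"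

definition ptd_homotopic :: "'a ptd \<Rightarrow> 'b ptd \<Rightarrow> ('a \<Rightarrow> 'b) \<Rightarrow> ('a \<Rightarrow> 'b) \<Rightarrow> bool" where
  "ptd_homotopic X Y = homotopic_with (\<lambda>h. h (snd X) = snd Y) (fst X) (fst Y)"


section \<open>The pointed homotopy category\<close>

text \<open>Morphisms of \<open>HTop\<^sub>*\<close> are pointed homotopy classes, represented as sets of maps.\<close>

definition hclass :: "'a ptd \<Rightarrow> 'b ptd \<Rightarrow> ('a \<Rightarrow> 'b) \<Rightarrow> ('a \<Rightarrow> 'b) set" where
  "hclass X Y f = {g. ptd_homotopic X Y f g}"

definition hmor :: "'a ptd \<Rightarrow> 'b ptd \<Rightarrow> ('a \<Rightarrow> 'b) set set" where
  "hmor X Y = {hclass X Y f | f. ptd_map X Y f}"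

definition hid :: "'a ptd \<Rightarrow> ('a \<Rightarrow> 'a) set" where
  "hid X = hclass X X id"

definition hcomp :: "'a ptd \<Rightarrow> 'c ptd \<Rightarrow> ('b \<Rightarrow> 'c) set \<Rightarrow> ('a \<Rightarrow> 'b) set \<Rightarrow> ('a \<Rightarrow> 'c) set" where
  "hcomp X Z G F = {h. \<exists>g\<in>G. \<exists>f\<in>F. ptd_homotopic X Z (g \<circ> f) h}"

definition hequiv :: "'a ptd \<Rightarrow> 'b ptd \<Rightarrow> bool" where
  "hequiv X Y \<longleftrightarrow>
     (\<exists>F\<in>hmor X Y. \<exists>G\<in>hmor Y X. hcomp X X G F = hid X \<and> hcomp Y Y F G = hid Y)"


section \<open>Polyhedra\<close>

definition abstract_complex :: "'v set set \<Rightarrow> bool" where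
  "abstract_complex K \<longleftrightarrow>
     (\<forall>s\<in>K. finite s \<and> s \<noteq> {}) \<and> (\<forall>s\<in>K. \<forall>t. t \<subseteq> s \<and> t \<noteq> {} \<longrightarrow> t \<in> K)"

text \<open>Points of the realization are given by their barycentric coordinates.\<close>

definition closed_cell :: "'v set \<Rightarrow> ('v \<Rightarrow> real) set" where
  "closed_cell s = {b. (\<forall>v. 0 \<le> b v) \<and> (\<forall>v. v \<notin> s \<longrightarrow> b v = 0) \<and> sum b s = 1}"

definition realization_points :: "'v set set \<Rightarrow> ('v \<Rightarrow> real) set" where
  "realization_points K = (\<Union>s\<in>K. closed_cell s)"

text \<open>The weak (CW) topology: each closed simplex carries its Euclidean topology.\<close>

definition realization :: "'v set set \<Rightarrow> ('v \<Rightarrow> real) topology" where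
  "realization K = topology (\<lambda>U. U \<subseteq> realization_points K \<and>
     (\<forall>s\<in>K. openin (subtopology (powertop_real UNIV) (closed_cell s)) (U \<inter> closed_cell s)))"

lemma openin_realization:
  "openin (realization K) U \<longleftrightarrow> U \<subseteq> realization_points K \<and>
     (\<forall>s\<in>K. openin (subtopology (powertop_real UNIV) (closed_cell s)) (U \<inter> closed_cell s))"
proof -
  let ?O = "\<lambda>s U. openin (subtopology (powertop_real UNIV) (closed_cell s)) (U \<inter> closed_cell s)"
  have Int: "?O s (A \<inter> B)" if "?O s A" "?O s B" for s :: "'a set" and A B
  proof -
    have "A \<inter> B \<inter> closed_cell s = (A \<inter> closed_cell s) \<inter> (B \<inter> closed_cell s)" by blast
    then show ?thesis using openin_Int[OF that] by simp
  qed
  have Un: "?O s (\<Union>\<U>)" if "\<And>A. A \<in> \<U> \<Longrightarrow> ?O s A" for s :: "'a set" and \<U>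
  proof -
    have "\<Union>\<U> \<inter> closed_cell s = \<Union>((\<lambda>A. A \<inter> closed_cell s) ` \<U>)" by blast
    moreover have "openin (subtopology (powertop_real UNIV) (closed_cell s))
        (\<Union>((\<lambda>A. A \<inter> closed_cell s) ` \<U>))"
      using that by (intro openin_Union) (elim imageE, simp)
    ultimately show ?thesis by simp
  qed
  have "istopology (\<lambda>U. U \<subseteq> realization_points K \<and> (\<forall>s\<in>K. ?O s U))"
    unfolding istopology_def
  proof (intro conjI allI impI)
    fix A B assume "A \<subseteq> realization_points K \<and> (\<forall>s\<in>K. ?O s A)"
      and "B \<subseteq> realization_points K \<and> (\<forall>s\<in>K. ?O s B)"
    then show "A \<inter> B \<subseteq> realization_points K" "\<forall>s\<in>K. ?O s (A \<inter> B)"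
      by (auto intro!: Int)
  next
    fix \<U> assume "\<forall>U\<in>\<U>. U \<subseteq> realization_points K \<and> (\<forall>s\<in>K. ?O s U)"
    then show "\<Union>\<U> \<subseteq> realization_points K" "\<forall>s\<in>K. ?O s (\<Union>\<U>)"
      by (simp_all add: Un Union_least)
  qed
  then show ?thesis
    unfolding realization_def by simp
qed

text \<open>
  Vertices are taken from \<open>'u\<close> as well. This loses no homotopy type: a space on \<open>'u\<close> that is pointed
  homotopy equivalent to some polyhedron is dominated by a subcomplex with at most
  \<open>max |'u| \<aleph>\<^sub>0\<close> simplices, hence equivalent to a polyhedron of that size (and for finite \<open>'u\<close> to
  a discrete polyhedron with at most \<open>|'u|\<close> vertices).
\<close>

definition HPol :: "'u ptd \<Rightarrow> bool" where
  "HPol P \<longleftrightarrow> ptd_space P \<and>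
     (\<exists>(K :: 'u set set) b. abstract_complex K \<and> b \<in> realization_points K \<and>
        hequiv P (realization K, b))"


section \<open>Inverse systems and expansions\<close>

record ('i, 'u) inv_system =
  Idx :: "'i set"
  Leq :: "'i \<Rightarrow> 'i \<Rightarrow> bool"
  Obj :: "'i \<Rightarrow> 'u ptd"
  Bond :: "'i \<Rightarrow> 'i \<Rightarrow> ('u \<Rightarrow> 'u) set"

text \<open>\<open>Bond S i j\<close> is the bonding morphism from \<open>Obj S j\<close> to \<open>Obj S i\<close>, for \<open>i \<le> j\<close>.\<close>

definition directed_set :: "'i set \<Rightarrow> ('i \<Rightarrow> 'i \<Rightarrow> bool) \<Rightarrow> bool" where
  "directed_set I r \<longleftrightarrow> I \<noteq> {} \<and> (\<forall>i\<in>I. r i i) \<and>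
     (\<forall>i\<in>I. \<forall>j\<in>I. \<forall>k\<in>I. r i j \<and> r j k \<longrightarrow> r i k) \<and>
     (\<forall>i\<in>I. \<forall>j\<in>I. \<exists>k\<in>I. r i k \<and> r j k)"

definition HPol_system :: "('i, 'u) inv_system \<Rightarrow> bool" where
  "HPol_system S \<longleftrightarrow> directed_set (Idx S) (Leq S) \<and>
     (\<forall>i\<in>Idx S. HPol (Obj S i)) \<and>
     (\<forall>i\<in>Idx S. \<forall>j\<in>Idx S. Leq S i j \<longrightarrow> Bond S i j \<in> hmor (Obj S j) (Obj S i)) \<and>
     (\<forall>i\<in>Idx S. Bond S i i = hid (Obj S i)) \<and>
     (\<forall>i\<in>Idx S. \<forall>j\<in>Idx S. \<forall>k\<in>Idx S. Leq S i j \<and> Leq S j k \<longrightarrow>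
        hcomp (Obj S k) (Obj S i) (Bond S i j) (Bond S j k) = Bond S i k)"

definition HPol_expansion ::
    "'u ptd \<Rightarrow> ('i, 'u) inv_system \<Rightarrow> ('i \<Rightarrow> ('u \<Rightarrow> 'u) set) \<Rightarrow> bool" where
  "HPol_expansion X S p \<longleftrightarrow> HPol_system S \<and>
     (\<forall>i\<in>Idx S. p i \<in> hmor X (Obj S i)) \<and>
     (\<forall>i\<in>Idx S. \<forall>j\<in>Idx S. Leq S i j \<longrightarrow> hcomp X (Obj S i) (Bond S i j) (p j) = p i) \<and>
     \<comment> \<open>(E1)\<close>
     (\<forall>P :: 'u ptd. HPol P \<longrightarrow> (\<forall>h\<in>hmor X P. \<exists>i\<in>Idx S. \<exists>f\<in>hmor (Obj S i) P. hcomp X P f (p i) = h)) \<and>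
     \<comment> \<open>(E2)\<close>
     (\<forall>P :: 'u ptd. HPol P \<longrightarrow> (\<forall>i\<in>Idx S. \<forall>f0\<in>hmor (Obj S i) P. \<forall>f1\<in>hmor (Obj S i) P.
        hcomp X P f0 (p i) = hcomp X P f1 (p i) \<longrightarrow>
        (\<exists>j\<in>Idx S. Leq S i j \<and>
           hcomp (Obj S j) P f0 (Bond S i j) = hcomp (Obj S j) P f1 (Bond S i j))))"


section \<open>Homotopy groups\<close>

definition sph :: "nat \<Rightarrow> (nat \<Rightarrow> real) ptd" where
  "sph k = (nsphere k, \<lambda>i. if i = 0 then 1 else 0)"

text \<open>
  The pinch of \<open>S\<^sup>k\<close> (\<open>k \<ge> 1\<close>) along the equator \<open>x\<^sub>1 = 0\<close>, which contains the base point \<open>e\<^sub>0\<close>.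
  On the hemisphere \<open>x\<^sub>1 \<ge> 0\<close> the map \<open>x \<mapsto> 2 x\<^sub>1 x - e\<^sub>1\<close> doubles the angle from the pole \<open>e\<^sub>1\<close>
  and so collapses the equator to \<open>-e\<^sub>1\<close>; \<open>pinch\<close> is this map followed by the rotation
  \<open>(a, b) \<mapsto> (-b, a)\<close> of the \<open>(x\<^sub>0, x\<^sub>1)\<close>-plane taking \<open>-e\<^sub>1\<close> to \<open>e\<^sub>0\<close>. On \<open>x\<^sub>1 \<le> 0\<close> it is in the
  same way \<open>x \<mapsto> e\<^sub>1 - 2 x\<^sub>1 x\<close> followed by \<open>(a, b) \<mapsto> (b, -a)\<close>. Both halves thus have degree one
  onto \<open>S\<^sup>k\<close> relative to the equator. For \<open>k = 1\<close> it is \<open>(cos t, sin t) \<mapsto> (cos 2t, sin 2t)\<close>, so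
  that \<open>ptd_add\<close> is concatenation of loops.
\<close>

definition pinch :: "(nat \<Rightarrow> real) \<Rightarrow> (nat \<Rightarrow> real)" where
  "pinch x = (\<lambda>i. if i = 0 then 1 - 2 * (x 1)\<^sup>2
                  else if i = 1 then 2 * x 1 * x 0
                  else 2 * \<bar>x 1\<bar> * x i)"

definition ptd_add ::
    "((nat \<Rightarrow> real) \<Rightarrow> 'a) \<Rightarrow> ((nat \<Rightarrow> real) \<Rightarrow> 'a) \<Rightarrow> ((nat \<Rightarrow> real) \<Rightarrow> 'a)" where
  "ptd_add f g x = (if 0 \<le> x 1 then f (pinch x) else g (pinch x))"

lemma continuous_map_pinch:
  assumes "1 \<le> k"
  shows "continuous_map (nsphere k) (nsphere k) pinch"
proof -
  have proj: "continuous_map (nsphere k) euclideanreal (\<lambda>x. x i)" for i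
    unfolding nsphere by (intro continuous_map_from_subtopology continuous_map_product_projection) simp
  have "continuous_map (nsphere k) euclideanreal (\<lambda>x. pinch x i)" for i
    unfolding pinch_def by (cases "i = 0"; cases "i = 1") (auto intro!: continuous_intros proj)
  moreover have "pinch x \<in> {y. (\<Sum>i\<le>k. (y i)\<^sup>2) = 1 \<and> (\<forall>i>k. y i = 0)}"
    if "x \<in> topspace (nsphere k)" for x
  proof -
    from that have x: "(\<Sum>i\<le>k. (x i)\<^sup>2) = 1" "\<forall>i>k. x i = 0"
      by (auto simp: nsphere)
    have split: "(\<Sum>i\<le>k. h i) = h 0 + h 1 + (\<Sum>i\<in>{2..k}. h i)" for h :: "nat \<Rightarrow> real"
    proof -
      have "{..k} = insert 0 (insert 1 {2..k})"
        using assms by auto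
      then show ?thesis by simp
    qed
    have "(\<Sum>i\<le>k. (pinch x i)\<^sup>2) =
        (1 - 2 * (x 1)\<^sup>2)\<^sup>2 + (2 * x 1 * x 0)\<^sup>2 + (\<Sum>i\<in>{2..k}. (2 * \<bar>x 1\<bar> * x i)\<^sup>2)"
      unfolding split by (auto simp: pinch_def intro!: sum.cong)
    also have "(\<Sum>i\<in>{2..k}. (2 * \<bar>x 1\<bar> * x i)\<^sup>2) = 4 * (x 1)\<^sup>2 * (\<Sum>i\<in>{2..k}. (x i)\<^sup>2)"
      by (simp add: sum_distrib_left power_mult_distrib)
    also have "(\<Sum>i\<in>{2..k}. (x i)\<^sup>2) = 1 - (x 0)\<^sup>2 - (x 1)\<^sup>2"
      using x(1) unfolding split by simp
    finally have "(\<Sum>i\<le>k. (pinch x i)\<^sup>2) = 1"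
      by (simp add: power2_eq_square algebra_simps)
    then show ?thesis
      using x(2) assms by (auto simp: pinch_def)
  qed
  ultimately show ?thesis
    by (subst (2) nsphere)
       (auto simp: continuous_map_in_subtopology continuous_map_componentwise_UNIV)
qed

lemma ptd_map_ptd_add:
  assumes "1 \<le> k" "ptd_map (sph k) X f" "ptd_map (sph k) X g"
  shows "ptd_map (sph k) X (ptd_add f g)"
proof -
  have f: "continuous_map (nsphere k) (fst X) f" "f (snd (sph k)) = snd X"
    and g: "continuous_map (nsphere k) (fst X) g" "g (snd (sph k)) = snd X"
    using assms by (auto simp: ptd_map_def sph_def)
  have base: "pinch x = snd (sph k)" if "x 1 = 0" for x
    using that by (auto simp: pinch_def sph_def)
  have proj: "continuous_map (nsphere k) euclideanreal (\<lambda>x. x 1)"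
    unfolding nsphere by (intro continuous_map_from_subtopology continuous_map_product_projection) simp
  have cont: "continuous_map (nsphere k) (fst X) (f \<circ> pinch)" "continuous_map (nsphere k) (fst X) (g \<circ> pinch)"
    using f g continuous_map_pinch[OF assms(1)] by (blast intro: continuous_map_compose)+
  have "continuous_map (nsphere k) (fst X) (\<lambda>x. if 0 \<le> x 1 then (f \<circ> pinch) x else (g \<circ> pinch) x)"
  proof (rule continuous_map_cases_le)
    show "(f \<circ> pinch) x = (g \<circ> pinch) x" if "x \<in> topspace (nsphere k)" "0 = x 1" for x
      using that base f g by simp
  qed (use cont proj in \<open>simp_all add: continuous_map_from_subtopology del: comp_apply One_nat_def\<close>)
  moreover have "ptd_add f g = (\<lambda>x. if 0 \<le> x 1 then (f \<circ> pinch) x else (g \<circ> pinch) x)"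
    by (simp add: ptd_add_def fun_eq_iff)
  moreover have "ptd_add f g (snd (sph k)) = snd X"
    using f base[of "snd (sph k)"] by (simp add: ptd_add_def sph_def)
  ultimately show ?thesis
    by (simp add: ptd_map_def sph_def)
qed

definition homotopy_group :: "nat \<Rightarrow> 'a ptd \<Rightarrow> ((nat \<Rightarrow> real) \<Rightarrow> 'a) set monoid" where
  "homotopy_group k X = \<lparr>carrier = hmor (sph k) X,
     mult = (\<lambda>F G. {h. \<exists>f\<in>F. \<exists>g\<in>G. ptd_homotopic (sph k) X (ptd_add f g) h}),
     one = hclass (sph k) X (\<lambda>_. snd X)\<rparr>"


section \<open>Topological shape groups\<close>

text \<open>
  The shape group of a pointed space is computed from an expansion; only the inverse system \<open>S\<close> of
  the expansion enters. The component \<open>F i\<close> is the composite of the shape morphism \<open>F\<close> with the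
  projection \<open>p i\<close>.
\<close>

definition shape_mor :: "nat \<Rightarrow> ('i, 'u) inv_system \<Rightarrow> ('i \<Rightarrow> ((nat \<Rightarrow> real) \<Rightarrow> 'u) set) set" where
  "shape_mor k S = {F \<in> (\<Pi>\<^sub>E i\<in>Idx S. hmor (sph k) (Obj S i)).
     \<forall>i\<in>Idx S. \<forall>j\<in>Idx S. Leq S i j \<longrightarrow> hcomp (sph k) (Obj S i) (Bond S i j) (F j) = F i}"

definition shape_group ::
    "nat \<Rightarrow> ('i, 'u) inv_system \<Rightarrow> ('i \<Rightarrow> ((nat \<Rightarrow> real) \<Rightarrow> 'u) set) monoid" where
  "shape_group k S = \<lparr>carrier = shape_mor k S,
     mult = (\<lambda>F G. \<lambda>i\<in>Idx S. F i \<otimes>\<^bsub>homotopy_group k (Obj S i)\<^esub> G i),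
     one = (\<lambda>i\<in>Idx S. \<one>\<^bsub>homotopy_group k (Obj S i)\<^esub>)\<rparr>"

definition shape_nbhd :: "nat \<Rightarrow> ('i, 'u) inv_system \<Rightarrow> 'i \<Rightarrow> ('i \<Rightarrow> ((nat \<Rightarrow> real) \<Rightarrow> 'u) set)
    \<Rightarrow> ('i \<Rightarrow> ((nat \<Rightarrow> real) \<Rightarrow> 'u) set) set" where
  "shape_nbhd k S i F = {G \<in> shape_mor k S. F i = G i}"

definition shape_topology ::
    "nat \<Rightarrow> ('i, 'u) inv_system \<Rightarrow> ('i \<Rightarrow> ((nat \<Rightarrow> real) \<Rightarrow> 'u) set) topology" where
  "shape_topology k S =
     topology_generated_by {shape_nbhd k S i F | i F. i \<in> Idx S \<and> F \<in> shape_mor k S}"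

text \<open>The generating sets are in fact a basis, by directedness.\<close>

lemma openin_shape_topology:
  assumes "HPol_system S"
  shows "openin (shape_topology k S) U \<longleftrightarrow>
    U \<subseteq> shape_mor k S \<and> (\<forall>F\<in>U. \<exists>i\<in>Idx S. shape_nbhd k S i F \<subseteq> U)"
proof
  let ?B = "{shape_nbhd k S i F | i F. i \<in> Idx S \<and> F \<in> shape_mor k S}"
  have dir: "Idx S \<noteq> {}" "\<And>i j. i \<in> Idx S \<Longrightarrow> j \<in> Idx S \<Longrightarrow> \<exists>l\<in>Idx S. Leq S i l \<and> Leq S j l"
    using assms unfolding HPol_system_def directed_set_def by blast+
  have mono: "shape_nbhd k S l F \<subseteq> shape_nbhd k S i F"
    if "i \<in> Idx S" "l \<in> Idx S" "Leq S i l" "F \<in> shape_mor k S" for i l F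
  proof
    fix G assume G: "G \<in> shape_nbhd k S l F"
    then have GF: "G \<in> shape_mor k S" "F l = G l"
      by (simp_all add: shape_nbhd_def)
    have "H i = hcomp (sph k) (Obj S i) (Bond S i l) (H l)" if "H \<in> shape_mor k S" for H
      using that \<open>i \<in> Idx S\<close> \<open>l \<in> Idx S\<close> \<open>Leq S i l\<close> by (simp add: shape_mor_def)
    then have "F i = G i"
      using GF \<open>F \<in> shape_mor k S\<close> by metis
    then show "G \<in> shape_nbhd k S i F"
      using GF by (simp add: shape_nbhd_def)
  qed
  {
    assume "openin (shape_topology k S) U"
    then have "generate_topology_on ?B U"
      by (simp add: shape_topology_def openin_topology_generated_by_iff)
    then show "U \<subseteq> shape_mor k S \<and> (\<forall>F\<in>U. \<exists>i\<in>Idx S. shape_nbhd k S i F \<subseteq> U)"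
    proof induction
      case (Int a b)
      show ?case
      proof (intro conjI ballI)
        show "a \<inter> b \<subseteq> shape_mor k S" using Int by blast
        fix F assume F: "F \<in> a \<inter> b"
        then obtain i j where ij: "i \<in> Idx S" "shape_nbhd k S i F \<subseteq> a"
            "j \<in> Idx S" "shape_nbhd k S j F \<subseteq> b"
          using Int by blast
        then obtain l where "l \<in> Idx S" "Leq S i l" "Leq S j l"
          using dir by blast
        moreover have "F \<in> shape_mor k S"
          using F Int by blast
        ultimately have "shape_nbhd k S l F \<subseteq> a \<inter> b"
          using mono[of i l F] mono[of j l F] ij by auto
        with \<open>l \<in> Idx S\<close> show "\<exists>i\<in>Idx S. shape_nbhd k S i F \<subseteq> a \<inter> b" ..
      qed
    next
      case (Basis s)
      then obtain i F where "i \<in> Idx S" "s = shape_nbhd k S i F"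
        by blast
      moreover from this have "shape_nbhd k S i G = s" if "G \<in> s" for G
        using that by (simp add: shape_nbhd_def)
      moreover from calculation have "s \<subseteq> shape_mor k S"
        by (simp add: shape_nbhd_def)
      ultimately show ?case by blast
    qed blast+
  }
  assume U: "U \<subseteq> shape_mor k S \<and> (\<forall>F\<in>U. \<exists>i\<in>Idx S. shape_nbhd k S i F \<subseteq> U)"
  have "openin (shape_topology k S) (\<Union>{V \<in> ?B. V \<subseteq> U})"
    unfolding shape_topology_def by (intro openin_Union) (blast intro: topology_generated_by_Basis)
  moreover have "\<Union>{V \<in> ?B. V \<subseteq> U} = U"
  proof
    show "U \<subseteq> \<Union>{V \<in> ?B. V \<subseteq> U}"
    proof
      fix F assume "F \<in> U"
      with U obtain i where "i \<in> Idx S" "shape_nbhd k S i F \<subseteq> U" "F \<in> shape_mor k S" by blast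
      moreover from this have "F \<in> shape_nbhd k S i F" by (simp add: shape_nbhd_def)
      ultimately show "F \<in> \<Union>{V \<in> ?B. V \<subseteq> U}" by blast
    qed
  qed blast
  ultimately show "openin (shape_topology k S) U" by simp
qed

definition shape_group_discrete :: "nat \<Rightarrow> ('i, 'u) inv_system \<Rightarrow> bool" where
  "shape_group_discrete k S \<longleftrightarrow> shape_topology k S = discrete_topology (shape_mor k S)"

definition top_group_embeds ::
    "('a, 'm) monoid_scheme \<Rightarrow> 'a topology \<Rightarrow> ('b, 'n) monoid_scheme \<Rightarrow> 'b topology \<Rightarrow> bool" where
  "top_group_embeds G T H U \<longleftrightarrow>
     (\<exists>K. subgroup K H \<and>
        (\<exists>\<phi>\<in>iso G (H\<lparr>carrier := K\<rparr>). homeomorphic_map T (subtopology U K) \<phi>))"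

end

theory Submission
  imports Defs
begin

text \<open>
  If \<open>f p\<^sub>i = id\<close> then (E2) turns \<open>p\<^sub>j f p\<^sub>i = p\<^sub>j\<close> into \<open>F\<^sub>j = p\<^sub>j f F\<^sub>i\<close> for every shape morphism \<open>F\<close>,
  so \<open>F\<close> is determined by \<open>F\<^sub>i\<close>; when \<open>X\<close> is a polyhedron up to homotopy, such \<open>f\<close> and \<open>i\<close> exist by
  (E1), and the topology is discrete. Conversely, discreteness provides an index \<open>j\<close> such that
  \<open>F \<mapsto> F\<^sub>j\<close> has trivial kernel. By (E1) the projection to stage \<open>j\<close> factors through some stage \<open>l\<close>
  of the other expansion, hence composition with the projection to stage \<open>l\<close> is an injective
  homomorphism into a discrete group.

  Injectivity from a trivial kernel needs the group laws of the homotopy groups. They are proved by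
  explicit homotopies of self-maps of the sphere; associativity
  \<open>(f + g) + h = (f + g) + (0 + h) = (f + 0) + (g + h) = f + (g + h)\<close> follows from the unit laws and
  the interchange in the middle.
\<close>


section \<open>The pointed homotopy category\<close>

lemma ptd_homotopic_refl: "ptd_map X Y f \<Longrightarrow> ptd_homotopic X Y f f"
  by (simp add: ptd_homotopic_def ptd_map_def)

lemma ptd_homotopic_sym: "ptd_homotopic X Y f g \<Longrightarrow> ptd_homotopic X Y g f"
  unfolding ptd_homotopic_def by (rule homotopic_with_symD)

lemma ptd_homotopic_trans:
  "ptd_homotopic X Y f g \<Longrightarrow> ptd_homotopic X Y g h \<Longrightarrow> ptd_homotopic X Y f h"
  unfolding ptd_homotopic_def by (rule homotopic_with_trans)

lemma ptd_homotopic_imp_ptd_map: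
  assumes "ptd_homotopic X Y f g"
  shows "ptd_map X Y f" "ptd_map X Y g"
  using homotopic_with_imp_continuous_maps[OF assms[unfolded ptd_homotopic_def]]
    homotopic_with_imp_property[OF assms[unfolded ptd_homotopic_def]]
  by (simp_all add: ptd_map_def)

lemma ptd_map_compose: "ptd_map X Y f \<Longrightarrow> ptd_map Y Z g \<Longrightarrow> ptd_map X Z (g \<circ> f)"
  by (auto simp: ptd_map_def intro: continuous_map_compose)

lemma ptd_map_id: "ptd_map X X id"
  by (simp add: ptd_map_def)

lemma ptd_map_const: "ptd_space Y \<Longrightarrow> ptd_map X Y (\<lambda>_. snd Y)"
  by (simp add: ptd_map_def ptd_space_def)

lemma ptd_homotopic_compose_left:
  assumes "ptd_homotopic X Y f g" "ptd_map Y Z h"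
  shows "ptd_homotopic X Z (h \<circ> f) (h \<circ> g)"
  using assms unfolding ptd_homotopic_def ptd_map_def
  by (auto intro: homotopic_with_compose_continuous_map_left)

lemma ptd_homotopic_compose_right:
  assumes "ptd_homotopic Y Z f g" "ptd_map X Y h"
  shows "ptd_homotopic X Z (f \<circ> h) (g \<circ> h)"
  using assms unfolding ptd_homotopic_def ptd_map_def
  by (auto intro: homotopic_with_compose_continuous_map_right)

lemma ptd_homotopic_compose:
  assumes "ptd_homotopic X Y f f'" "ptd_homotopic Y Z g g'"
  shows "ptd_homotopic X Z (g \<circ> f) (g' \<circ> f')"
  using assms
  by (blast intro: ptd_homotopic_trans ptd_homotopic_compose_left ptd_homotopic_compose_right
      ptd_homotopic_imp_ptd_map)

text \<open>That \<open>f\<close> is a pointed map makes homotopy reflexive at \<open>f\<close>, so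
  \<open>f\<close> lies in its own class; the class of any other function is empty.\<close>

lemma hclass_eq_iff:
  assumes "ptd_map X Y f"
  shows "hclass X Y f = hclass X Y g \<longleftrightarrow> ptd_homotopic X Y f g"
proof
  assume "hclass X Y f = hclass X Y g"
  then have "ptd_homotopic X Y g f"
    using ptd_homotopic_refl[OF assms] by (auto simp: hclass_def)
  then show "ptd_homotopic X Y f g"
    by (rule ptd_homotopic_sym)
qed (auto simp: hclass_def intro: ptd_homotopic_trans ptd_homotopic_sym)

lemma hclass_in_hmor: "ptd_map X Y f \<Longrightarrow> hclass X Y f \<in> hmor X Y"
  by (auto simp: hmor_def)

lemma hmorE:
  assumes "F \<in> hmor X Y"
  obtains f where "ptd_map X Y f" "F = hclass X Y f"
  using assms by (auto simp: hmor_def)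

text \<open>Homotopy is a congruence for composition, so one pair of representatives determines the
  composite class.\<close>

lemma hcomp_hclass:
  assumes "ptd_map X Y f" "ptd_map Y Z g"
  shows "hcomp X Z (hclass Y Z g) (hclass X Y f) = hclass X Z (g \<circ> f)"
proof (intro Set.set_eqI iffI)
  fix h assume "h \<in> hcomp X Z (hclass Y Z g) (hclass X Y f)"
  then show "h \<in> hclass X Z (g \<circ> f)"
    unfolding hcomp_def hclass_def by (blast intro: ptd_homotopic_trans ptd_homotopic_compose)
next
  fix h assume "h \<in> hclass X Z (g \<circ> f)"
  then show "h \<in> hcomp X Z (hclass Y Z g) (hclass X Y f)"
    using assms unfolding hcomp_def hclass_def by (blast intro: ptd_homotopic_refl)
qed

lemma hcomp_in_hmor:
  assumes "F \<in> hmor X Y" "G \<in> hmor Y Z"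
  shows "hcomp X Z G F \<in> hmor X Z"
  using assms by (elim hmorE) (simp add: hcomp_hclass hclass_in_hmor ptd_map_compose)

lemma hcomp_assoc:
  assumes "F \<in> hmor W X" "G \<in> hmor X Y" "H \<in> hmor Y Z"
  shows "hcomp W Z H (hcomp W Y G F) = hcomp W Z (hcomp X Z H G) F"
proof -
  obtain f g h where "ptd_map W X f" "ptd_map X Y g" "ptd_map Y Z h"
    and eq: "F = hclass W X f" "G = hclass X Y g" "H = hclass Y Z h"
    using assms by (metis hmorE)
  then show ?thesis
    using ptd_map_compose[of W X f Y g] ptd_map_compose[of X Y g Z h]
    by (simp add: eq hcomp_hclass o_assoc)
qed

lemma hid_in_hmor: "hid X \<in> hmor X X"
  by (simp add: hid_def hclass_in_hmor ptd_map_id)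

lemma hcomp_hid_left:
  assumes "F \<in> hmor X Y"
  shows "hcomp X Y (hid Y) F = F"
  using assms by (elim hmorE) (simp add: hid_def hcomp_hclass[OF _ ptd_map_id])


section \<open>Self-maps of the sphere and homotopy groups\<close>

definition pole :: "nat \<Rightarrow> real" where
  "pole = (\<lambda>i. if i = 0 then 1 else 0)"

lemma pole_simps [simp]: "pole 0 = 1" "pole (Suc n) = 0"
  by (simp_all add: pole_def)

lemma sph_simps [simp]: "fst (sph k) = nsphere k" "snd (sph k) = pole"
  by (simp_all add: sph_def pole_def)

lemma in_nsphere:
  "x \<in> topspace (nsphere k) \<longleftrightarrow> (\<Sum>i\<le>k. (x i)\<^sup>2) = 1 \<and> (\<forall>i>k. x i = 0)"
  by (simp add: nsphere)

lemma sum_split_01: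
  fixes h :: "nat \<Rightarrow> real"
  assumes "1 \<le> k"
  shows "(\<Sum>i\<le>k. h i) = h 0 + h 1 + (\<Sum>i\<in>{2..k}. h i)"
proof -
  have "{..k} = insert 0 (insert 1 {2..k})"
    using assms by auto
  then show ?thesis by simp
qed

lemma in_nsphere_01:
  assumes "1 \<le> k"
  shows "x \<in> topspace (nsphere k) \<longleftrightarrow>
    (x 0)\<^sup>2 + (x 1)\<^sup>2 + (\<Sum>i\<in>{2..k}. (x i)\<^sup>2) = 1 \<and> (\<forall>i>k. x i = 0)"
  by (simp add: in_nsphere sum_split_01[OF assms])

lemma pole_in_nsphere [simp]: "pole \<in> topspace (nsphere k)"
  by (simp add: in_nsphere pole_def if_distrib[of "\<lambda>x. x\<^sup>2"] cong: if_cong)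

lemma continuous_map_into_nsphere:
  assumes "\<And>i. continuous_map Z euclideanreal (\<lambda>z. f z i)"
    and "\<And>z. z \<in> topspace Z \<Longrightarrow> f z \<in> topspace (nsphere k)"
  shows "continuous_map Z (nsphere k) f"
  using assms unfolding nsphere
  by (auto simp: continuous_map_in_subtopology continuous_map_componentwise_UNIV)

lemma continuous_map_cylinder_fst:
  "continuous_map (prod_topology (top_of_set {0..1::real}) X) euclideanreal fst"
  using continuous_map_fst continuous_map_in_subtopology by blast

lemma continuous_map_cylinder_nsphere:
  assumes "continuous_map (nsphere k) (nsphere m) f"
  shows "continuous_map (prod_topology T (nsphere k)) euclideanreal (\<lambda>z. f (snd z) i)"
  using continuous_map_compose[OF continuous_map_compose[OF continuous_map_snd assms]
      continuous_map_nsphere_projection]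
  by (simp add: o_def)

section \<open>Radial projection and relative homotopies of self-maps of the sphere\<close>

definition normalize_sph :: "nat \<Rightarrow> (nat \<Rightarrow> real) \<Rightarrow> (nat \<Rightarrow> real)" where
  "normalize_sph k v = (\<lambda>i. v i / sqrt (\<Sum>j\<le>k. (v j)\<^sup>2))"

lemma normalize_id: "x \<in> topspace (nsphere k) \<Longrightarrow> normalize_sph k x = x"
  by (simp add: normalize_sph_def in_nsphere)

lemma continuous_map_normalize:
  assumes cont: "\<And>i. continuous_map Z euclideanreal (\<lambda>z. v z i)"
    and nz: "\<And>z. z \<in> topspace Z \<Longrightarrow> \<exists>i\<le>k. v z i \<noteq> 0"
    and z: "\<And>z i. z \<in> topspace Z \<Longrightarrow> i > k \<Longrightarrow> v z i = 0"
  shows "continuous_map Z (nsphere k) (\<lambda>z. normalize_sph k (v z))"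
proof (rule continuous_map_into_nsphere)
  have pos: "(\<Sum>j\<le>k. (v z j)\<^sup>2) > 0" if "z \<in> topspace Z" for z
  proof -
    obtain i where i: "i \<le> k" "v z i \<noteq> 0"
      using nz[OF \<open>z \<in> topspace Z\<close>] by blast
    then show ?thesis
      by (intro sum_pos2[of _ i]) auto
  qed
  show "continuous_map Z euclideanreal (\<lambda>z. normalize_sph k (v z) i)" for i
    unfolding normalize_sph_def
    by (intro continuous_intros cont) (use pos in force)+
  show "normalize_sph k (v y) \<in> topspace (nsphere k)" if "y \<in> topspace Z" for y
    using pos[OF that] z[OF that]
    by (auto simp: in_nsphere normalize_sph_def power_divide sum_nonneg simp flip: sum_divide_distrib)
qed

text \<open>\<open>A = {pole}\<close> gives pointed homotopies. A closed hemisphere as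
  \<open>A\<close> allows a homotopy to be glued to an unrelated map on that hemisphere.\<close>

abbreviation rel_homotopic ::
    "nat \<Rightarrow> (nat \<Rightarrow> real) set \<Rightarrow> ((nat \<Rightarrow> real) \<Rightarrow> nat \<Rightarrow> real) \<Rightarrow> ((nat \<Rightarrow> real) \<Rightarrow> nat \<Rightarrow> real) \<Rightarrow> bool" where
  "rel_homotopic k A \<equiv> homotopic_with (\<lambda>h. \<forall>x\<in>A. h x = pole) (nsphere k) (nsphere k)"

lemma ptd_homotopic_sph: "ptd_homotopic (sph k) (sph k) = rel_homotopic k {pole}"
  by (simp add: ptd_homotopic_def fun_eq_iff)

text \<open>Radial projection pushes a nowhere vanishing family of vectors onto the sphere and fixes
  the points of the sphere, so both ends and the values on \<open>A\<close> survive. Hence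
  \<open>V\<close> may be any convenient formula in coordinates.\<close>

lemma rel_homotopic_normalize:
  assumes A: "A \<subseteq> topspace (nsphere k)"
    and f: "continuous_map (nsphere k) (nsphere k) f" and g: "continuous_map (nsphere k) (nsphere k) g"
    and cont: "\<And>i. continuous_map (prod_topology (top_of_set {0..1::real}) (nsphere k)) euclideanreal
        (\<lambda>z. V (fst z) (snd z) i)"
    and nz: "\<And>t x. t \<in> {0..1} \<Longrightarrow> x \<in> topspace (nsphere k) \<Longrightarrow> \<exists>i\<le>k. V t x i \<noteq> 0"
    and z: "\<And>t x i. t \<in> {0..1} \<Longrightarrow> x \<in> topspace (nsphere k) \<Longrightarrow> i > k \<Longrightarrow> V t x i = 0"
    and V0: "\<And>x. x \<in> topspace (nsphere k) \<Longrightarrow> V 0 x = f x"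
    and V1: "\<And>x. x \<in> topspace (nsphere k) \<Longrightarrow> V 1 x = g x"
    and VA: "\<And>t x. t \<in> {0..1} \<Longrightarrow> x \<in> A \<Longrightarrow> V t x = pole"
  shows "rel_homotopic k A f g"
proof -
  have "f x \<in> topspace (nsphere k)" "g x \<in> topspace (nsphere k)" if "x \<in> topspace (nsphere k)" for x
    using that f g continuous_map_image_subset_topspace by blast+
  moreover have "continuous_map (prod_topology (top_of_set {0..1}) (nsphere k)) (nsphere k)
      (\<lambda>z. normalize_sph k (V (fst z) (snd z)))"
    by (rule continuous_map_normalize) (use cont nz z in auto)
  moreover have "normalize_sph k pole = pole"
    by (simp add: normalize_id)
  ultimately have ex: "\<exists>h. continuous_map (prod_topology (top_of_set {0..1::real}) (nsphere k)) (nsphere k) h \<and>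
      (\<forall>x\<in>topspace (nsphere k). h (0, x) = f x) \<and> (\<forall>x\<in>topspace (nsphere k). h (1, x) = g x) \<and>
      (\<forall>t\<in>{0..1}. \<forall>x\<in>A. h (t, x) = pole)"
    using V0 V1 VA
    by (intro exI[of _ "\<lambda>z. normalize_sph k (V (fst z) (snd z))"]) (simp add: normalize_id)
  \<comment> \<open>The characterisation of \<open>homotopic_with\<close> used below asks for a
    property that depends only on the values on the sphere; this holds because \<open>A\<close> lies
    in it.\<close>
  have cong: "(\<forall>x\<in>A. h x = pole) \<longleftrightarrow> (\<forall>x\<in>A. h' x = pole)"
    if "\<And>x. x \<in> topspace (nsphere k) \<Longrightarrow> h x = h' x" for h h' :: "(nat \<Rightarrow> real) \<Rightarrow> nat \<Rightarrow> real"
    using A that by (metis subsetD)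
  show ?thesis
    using ex by (simp only: homotopic_with[of "nsphere k" "\<lambda>h. \<forall>x\<in>A. h x = pole", OF cong])
qed

text \<open>The segment between two unit vectors meets the origin only if they are antipodal, so the
  straight-line homotopy can be normalized.\<close>

lemma rel_homotopic_not_antipodal:
  assumes A: "A \<subseteq> topspace (nsphere k)"
    and f: "continuous_map (nsphere k) (nsphere k) f" and g: "continuous_map (nsphere k) (nsphere k) g"
    and fA: "\<And>x. x \<in> A \<Longrightarrow> f x = pole" and gA: "\<And>x. x \<in> A \<Longrightarrow> g x = pole"
    and ne: "\<And>x. x \<in> topspace (nsphere k) \<Longrightarrow> \<exists>i. f x i \<noteq> - g x i"
  shows "rel_homotopic k A f g"
proof (rule rel_homotopic_normalize[where V = "\<lambda>t x i. (1 - t) * f x i + t * g x i", OF A f g])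
  fix t :: real and x :: "nat \<Rightarrow> real" assume t: "t \<in> {0..1}" and x: "x \<in> topspace (nsphere k)"
  then have fx: "f x \<in> topspace (nsphere k)" and gx: "g x \<in> topspace (nsphere k)"
    using f g continuous_map_image_subset_topspace by blast+
  show "(1 - t) * f x i + t * g x i = 0" if "i > k" for i
    using fx gx that by (simp add: in_nsphere)
  show "\<exists>i\<le>k. (1 - t) * f x i + t * g x i \<noteq> 0"
  proof (rule ccontr)
    assume "\<not> ?thesis"
    then have eq: "(1 - t) * f x i = - (t * g x i)" if "i \<le> k" for i
      using that by (auto simp: eq_neg_iff_add_eq_0)
    \<comment> \<open>Comparing the norms of the unit vectors scaled by \<open>1 - t\<close> and
      \<open>t\<close> forces \<open>t = 1/2\<close>, and then \<open>f x\<close> and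
      \<open>g x\<close> are antipodal.\<close>
    have "(1 - t)\<^sup>2 = (\<Sum>i\<le>k. ((1 - t) * f x i)\<^sup>2)"
      using fx by (simp add: in_nsphere power_mult_distrib flip: sum_distrib_left)
    also have "\<dots> = t\<^sup>2"
      using gx eq by (simp add: in_nsphere power_mult_distrib flip: sum_distrib_left)
    finally have "1 - t = t"
      using t by (auto simp: power2_eq_iff)
    then have half: "t = 1/2"
      by simp
    obtain i where i: "f x i \<noteq> - g x i"
      using ne x by blast
    have "i \<le> k"
    proof (rule ccontr)
      assume "\<not> i \<le> k"
      then have "f x i = 0" "g x i = 0"
        using fx gx by (simp_all add: in_nsphere)
      then show False
        using i by simp
    qed
    then have "f x i = - g x i"
      using eq[of i] unfolding half by simp
    then show False
      using i by simp
  qed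
qed (use fA gA in \<open>auto intro!: continuous_intros continuous_map_cylinder_fst
    continuous_map_cylinder_nsphere f g simp: algebra_simps\<close>)

section \<open>Collapsing a hemisphere: the homotopies behind the unit and inverse laws\<close>

lemma pinch_eq_pole: "x 1 = 0 \<Longrightarrow> pinch x = pole"
  by (auto simp: pinch_def pole_def)

lemma pinch_simps:
  "pinch x 0 = 1 - 2 * (x 1)\<^sup>2" "pinch x (Suc 0) = 2 * x 1 * x 0"
  "2 \<le> i \<Longrightarrow> pinch x i = 2 * \<bar>x 1\<bar> * x i"
  by (auto simp: pinch_def)

text \<open>\<open>upper\<close> and \<open>lower\<close> are the universal cases of adding a
  constant: for pointed \<open>f\<close>, the sum of \<open>f\<close> and the constant map is
  \<open>f \<circ> upper\<close>, in the other order \<open>f \<circ> lower\<close>. The unit laws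
  thus reduce to homotopies from \<open>id\<close>.\<close>

definition upper :: "(nat \<Rightarrow> real) \<Rightarrow> (nat \<Rightarrow> real)" where
  "upper = ptd_add id (\<lambda>_. pole)"

definition lower :: "(nat \<Rightarrow> real) \<Rightarrow> (nat \<Rightarrow> real)" where
  "lower = ptd_add (\<lambda>_. pole) id"

text \<open>The reflection that interchanges the two hemispheres of \<open>ptd_add\<close>;
  precomposition with it will give inverses.\<close>

definition flip :: "(nat \<Rightarrow> real) \<Rightarrow> (nat \<Rightarrow> real)" where
  "flip x = x(1 := - x 1)"

lemma ptd_map_sph_const: "ptd_map (sph k) (sph k) (\<lambda>_. pole)"
  by (simp add: ptd_map_def)

lemma ptd_map_upper: "1 \<le> k \<Longrightarrow> ptd_map (sph k) (sph k) upper"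
  and ptd_map_lower: "1 \<le> k \<Longrightarrow> ptd_map (sph k) (sph k) lower"
  unfolding upper_def lower_def
  using ptd_map_ptd_add ptd_map_sph_const ptd_map_id by blast+

lemma flip_flip [simp]: "flip (flip x) = x"
  by (simp add: flip_def)

lemma flip_pole [simp]: "flip pole = pole"
  by (auto simp: flip_def pole_def)

lemma flip_at_1: "flip x 1 = - x 1" "flip x (Suc 0) = - x (Suc 0)"
  by (simp_all add: flip_def)

lemma pinch_flip: "pinch (flip x) = flip (pinch x)"
  by (auto simp: pinch_def flip_def)

lemma in_nsphere_flip: "x \<in> topspace (nsphere k) \<Longrightarrow> flip x \<in> topspace (nsphere k)"
proof -
  have "(flip x i)\<^sup>2 = (x i)\<^sup>2" for i
    by (simp add: flip_def)
  then show "x \<in> topspace (nsphere k) \<Longrightarrow> flip x \<in> topspace (nsphere k)"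
    by (auto simp: in_nsphere flip_def)
qed

lemma continuous_map_flip: "continuous_map (nsphere k) (nsphere k) flip"
proof (rule continuous_map_into_nsphere)
  show "continuous_map (nsphere k) euclideanreal (\<lambda>z. flip z i)" for i
    by (cases "i = 1") (simp_all add: flip_def continuous_map_nsphere_projection continuous_map_minus)
qed (rule in_nsphere_flip)

lemma ptd_map_flip: "ptd_map (sph k) (sph k) flip"
  by (simp add: ptd_map_def continuous_map_flip)

text \<open>\<open>pinch\<close> commutes with \<open>flip\<close>, and \<open>flip\<close> swaps
  the hemispheres. On the equator, where \<open>ptd_add\<close> always takes its first branch, both
  sides are \<open>pole\<close>.\<close>

lemma flip_upper_flip: "flip \<circ> upper \<circ> flip = lower"
proof
  fix x :: "nat \<Rightarrow> real"
  consider "x 1 < 0" | "x 1 = 0" | "x 1 > 0"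
    by linarith
  then show "(flip \<circ> upper \<circ> flip) x = lower x"
    by cases (auto simp: upper_def lower_def ptd_add_def pinch_flip pinch_eq_pole flip_at_1)
qed

lemma flip_lower_flip: "flip \<circ> lower \<circ> flip = upper"
  unfolding flip_upper_flip[symmetric] by (simp add: fun_eq_iff)

text \<open>The segment from \<open>x\<close> to \<open>upper x\<close> meets the origin only for
  \<open>x = - pole\<close>, at \<open>t = 1/2\<close>. The extra term pushes it off in the negative
  direction of coordinate 1 and vanishes at both ends and at \<open>pole\<close>. The sign matters:
  for \<open>x 1 < 0\<close> and \<open>t < 1\<close> that coordinate is already negative, so no new
  zero arises there.\<close>

lemma ptd_homotopic_id_upper:
  assumes k: "1 \<le> k"
  shows "ptd_homotopic (sph k) (sph k) id upper"
  unfolding ptd_homotopic_sph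
proof (rule rel_homotopic_normalize[where
      V = "\<lambda>t x i. (1 - t) * x i + t * upper x i - (if i = 1 then t * (1 - t) * (1 - x 0) else 0)"])
  have up: "continuous_map (nsphere k) (nsphere k) upper"
    using ptd_map_upper[OF k] by (simp add: ptd_map_def)
  then show "continuous_map (nsphere k) (nsphere k) upper" .
  have c: "continuous_map (prod_topology T (nsphere k)) euclideanreal (\<lambda>z. snd z i)" for i and T :: "real topology"
    using continuous_map_cylinder_nsphere[OF continuous_map_id] by simp
  show "continuous_map (prod_topology (top_of_set {0..1}) (nsphere k)) euclideanreal
      (\<lambda>z. (1 - fst z) * snd z i + fst z * upper (snd z) i
        - (if i = 1 then fst z * (1 - fst z) * (1 - snd z 0) else 0))" for i
    by (cases "i = 1")
      (auto intro!: continuous_intros continuous_map_cylinder_fst continuous_map_cylinder_nsphere[OF up] c)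
  fix t :: real and x :: "nat \<Rightarrow> real" assume t: "t \<in> {0..1}" and x: "x \<in> topspace (nsphere k)"
  have ux: "upper x \<in> topspace (nsphere k)"
    using x up continuous_map_image_subset_topspace by blast
  show "(1 - t) * x i + t * upper x i - (if i = 1 then t * (1 - t) * (1 - x 0) else 0) = 0" if "i > k" for i
    using that ux x k by (simp add: in_nsphere)
  show "\<exists>i\<le>k. (1 - t) * x i + t * upper x i - (if i = 1 then t * (1 - t) * (1 - x 0) else 0) \<noteq> 0"
  proof (rule ccontr)
    assume "\<not> ?thesis"
    then have eq: "(1 - t) * x i + t * upper x i = (if i = 1 then t * (1 - t) * (1 - x 0) else 0)"
      if "i \<le> k" for i
      using that by auto
    define X u where "X = x 0" and "u = x 1"
    have S: "X\<^sup>2 + u\<^sup>2 + (\<Sum>i\<in>{2..k}. (x i)\<^sup>2) = 1"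
      using x in_nsphere_01[OF k] by (simp add: X_def u_def)
    moreover have "0 \<le> (\<Sum>i\<in>{2..k}. (x i)\<^sup>2)"
      by (simp add: sum_nonneg)
    ultimately have "X\<^sup>2 \<le> 1" "u\<^sup>2 \<le> 1"
      by (smt (verit) zero_le_power2)+
    then have X1: "-1 \<le> X" "X \<le> 1" and u1: "u \<le> 1"
      by (simp_all add: abs_square_le_1 abs_le_iff)
    show False
    proof (cases "0 \<le> u")
      case True
      then have up: "upper x = pinch x"
        by (simp add: upper_def ptd_add_def u_def)
      have e0: "(1 - t) * X + t * (1 - 2 * u\<^sup>2) = 0"
        using eq[of 0] by (simp add: up pinch_simps X_def u_def)
      have e1: "(1 - t) * u + t * (2 * u * X) = t * (1 - t) * (1 - X)"
        using eq[of 1] k by (simp add: up pinch_simps X_def u_def)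
      \<comment> \<open>The coefficient of \<open>x i\<close> is a sum of nonnegative terms that
        vanishes only for \<open>t = 1\<close> and \<open>u = 0\<close>, which \<open>e0\<close>
        excludes. This leaves the circle in the first two coordinates.\<close>
      have e2: "x i = 0" if i: "i \<in> {2..k}" for i
      proof (rule ccontr)
        assume "x i \<noteq> 0"
        moreover have "((1 - t) + 2 * t * u) * x i = 0"
          using eq[of i] i True by (simp add: up pinch_simps u_def algebra_simps)
        ultimately have "(1 - t) + 2 * t * u = 0"
          by simp
        moreover have "0 \<le> 1 - t" "0 \<le> 2 * t * u"
          using t True by simp_all
        ultimately have "t = 1" "t * u = 0"
          by linarith+
        then show False
          using e0 by simp
      qed
      have S1: "X\<^sup>2 + u\<^sup>2 = 1"
        using S e2 by simp
      have t0: "t \<noteq> 0"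
        using e0 e1 S1 by auto
      \<comment> \<open>Taking \<open>X\<close> times \<open>e1\<close> minus \<open>u\<close> times
        \<open>e0\<close>, a determinant with the vector \<open>x\<close>, cancels the contribution
        of \<open>(1 - t) * x\<close>.\<close>
      have "t * u = t * ((1 - t) * (1 - X) * X)"
      proof -
        have "X * ((1 - t) * u + t * (2 * u * X)) - u * ((1 - t) * X + t * (1 - 2 * u\<^sup>2))
            = 2 * t * u * (X\<^sup>2 + u\<^sup>2) - t * u"
          by (simp add: power2_eq_square algebra_simps)
        then show ?thesis
          unfolding e0 e1 S1 by (simp add: algebra_simps)
      qed
      then have u: "u = (1 - t) * (1 - X) * X"
        using t0 by simp
      show False
      proof (cases "X \<le> 0")
        case True
        have "0 \<le> (1 - t) * (1 - X) * (- X)"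
          using t X1 True by (intro mult_nonneg_nonneg) auto
        then have "u = 0"
          using u \<open>0 \<le> u\<close> by simp
        then have "X = -1"
          using S1 True by (simp add: power2_eq_1_iff)
        then show False
          using u \<open>u = 0\<close> e0 by simp
      next
        case False
        show False
        proof (cases "X = 1")
          case True
          then show False
            using e0 S1 by simp
        next
          case ne: False
          \<comment> \<open>Now \<open>0 < X < 1\<close>. Bounding the square of \<open>u\<close> by
            \<open>u\<close> lets the factor \<open>1 - X\<close> cancel and leaves
            \<open>1 + X\<close> at most \<open>(1 - t) * X\<close>, hence at most
            \<open>X\<close>.\<close>
          have "(1 - X) * (1 + X) = u\<^sup>2"
            using S1 by (simp add: power2_eq_square algebra_simps)
          also have "\<dots> \<le> u"
            using \<open>0 \<le> u\<close> u1 by (simp add: power2_eq_square mult_left_le)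
          also have "\<dots> = (1 - X) * ((1 - t) * X)"
            using u by (simp add: algebra_simps)
          finally have "1 + X \<le> (1 - t) * X"
            using ne X1 by simp
          moreover have "(1 - t) * X \<le> 1 * X"
            using t False by (intro mult_right_mono) auto
          ultimately show False
            by simp
        qed
      qed
    next
      case False
      then have up: "upper x = pole"
        by (simp add: upper_def ptd_add_def u_def)
      have e0: "(1 - t) * X + t = 0"
        using eq[of 0] by (simp add: up X_def)
      then have "t \<noteq> 1"
        by auto
      moreover have "(1 - t) * u = (1 - t) * (t * (1 - X))"
        using eq[of 1] k by (simp add: up X_def u_def algebra_simps)
      ultimately have "u = t * (1 - X)"
        by simp
      then show False
        using False t X1 by simp
    qed
  qed
qed (use pole_in_nsphere in \<open>auto simp: upper_def ptd_add_def pinch_eq_pole fun_eq_iff algebra_simps\<close>)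

lemma ptd_homotopic_id_lower:
  assumes "1 \<le> k"
  shows "ptd_homotopic (sph k) (sph k) id lower"
proof -
  have "ptd_homotopic (sph k) (sph k) (flip \<circ> id \<circ> flip) (flip \<circ> upper \<circ> flip)"
    using ptd_homotopic_compose_right[OF ptd_homotopic_compose_left[OF
          ptd_homotopic_id_upper[OF assms] ptd_map_flip] ptd_map_flip] .
  moreover have "flip \<circ> id \<circ> flip = id"
    by (simp add: fun_eq_iff)
  ultimately show ?thesis
    by (simp add: flip_upper_flip)
qed


text \<open>Since \<open>pinch\<close> commutes with \<open>flip\<close>, the sum is
  \<open>pinch\<close> after folding the sphere onto a closed hemisphere, which is contractible.
  Composition with \<open>f \<circ> flip\<close> turns this into left inverses.\<close>

lemma ptd_homotopic_ptd_add_flip: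
  assumes k: "1 \<le> k"
  shows "ptd_homotopic (sph k) (sph k) (ptd_add id flip) (\<lambda>_. pole)"
proof -
  let ?Z = "prod_topology (top_of_set {0..1::real}) (nsphere k)"
  text \<open>Contract the closed upper hemisphere to \<open>pole\<close>, linearly in the coordinates other than \<open>x\<^sub>1\<close>.\<close>
  define K where "K t x i = (if i = 1 then sqrt ((1 - t) * (2 * t * (1 - x 0) + (1 - t) * (x 1)\<^sup>2))
    else (1 - t) * x i + t * pole i)" for t :: real and x :: "nat \<Rightarrow> real" and i
  have c: "continuous_map ?Z euclideanreal (\<lambda>z. snd z i)" for i
    using continuous_map_cylinder_nsphere[OF continuous_map_id] by simp
  have K: "continuous_map ?Z (nsphere k) (\<lambda>z. K (fst z) (snd z))"
  proof (rule continuous_map_into_nsphere)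
    show "continuous_map ?Z euclideanreal (\<lambda>z. K (fst z) (snd z) i)" for i
      by (cases "i = 1") (auto simp: K_def intro!: continuous_intros continuous_map_cylinder_fst c)
    fix z assume "z \<in> topspace ?Z"
    then obtain t x where z: "z = (t, x)" "t \<in> {0..1}" "x \<in> topspace (nsphere k)"
      by auto
    have S: "(x 0)\<^sup>2 + (x 1)\<^sup>2 + (\<Sum>i\<in>{2..k}. (x i)\<^sup>2) = 1" and out: "\<And>i. i > k \<Longrightarrow> x i = 0"
      using z in_nsphere_01[OF k] by simp_all
    have "0 \<le> (\<Sum>i\<in>{2..k}. (x i)\<^sup>2)"
      by (simp add: sum_nonneg)
    then have "(x 0)\<^sup>2 \<le> 1"
      using S by (smt (verit) zero_le_power2)
    then have "x 0 \<le> 1"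
      by (simp add: abs_square_le_1 abs_le_iff)
    then have "0 \<le> (1 - t) * (2 * t * (1 - x 0) + (1 - t) * (x 1)\<^sup>2)"
      using z by (intro mult_nonneg_nonneg add_nonneg_nonneg) auto
    \<comment> \<open>The radicand is 1 minus the squares of the other coordinates of
      \<open>K t x\<close>, which keeps \<open>K t x\<close> on the sphere; it is nonnegative
      because \<open>x 0 \<le> 1\<close>.\<close>
    then have K1: "(K t x 1)\<^sup>2 = (1 - t) * (2 * t * (1 - x 0) + (1 - t) * (x 1)\<^sup>2)"
      by (simp add: K_def)
    have "(\<Sum>i\<in>{2..k}. (K t x i)\<^sup>2) = (\<Sum>i\<in>{2..k}. (1 - t)\<^sup>2 * (x i)\<^sup>2)"
      by (intro sum.cong) (auto simp: K_def pole_def power_mult_distrib)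
    also have "\<dots> = (1 - t)\<^sup>2 * (1 - (x 0)\<^sup>2 - (x 1)\<^sup>2)"
      using S by (simp flip: sum_distrib_left)
    finally have "(K t x 0)\<^sup>2 + (K t x 1)\<^sup>2 + (\<Sum>i\<in>{2..k}. (K t x i)\<^sup>2) = 1"
      unfolding K1 by (simp add: K_def power2_eq_square algebra_simps)
    moreover have "K t x i = 0" if "i > k" for i
      using that k out by (simp add: K_def pole_def)
    ultimately show "K (fst z) (snd z) \<in> topspace (nsphere k)"
      using in_nsphere_01[OF k] z by simp
  qed
  \<comment> \<open>At \<open>t = 0\<close> this is the folding map; at \<open>t = 1\<close>
    coordinate 1 is zero, where \<open>pinch\<close> takes the value \<open>pole\<close>.\<close>
  have "K 0 x = (\<lambda>i. if i = 1 then \<bar>x 1\<bar> else x i)" for x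
    by (auto simp: K_def)
  then have "pinch (K 0 x) = ptd_add id flip x" for x
    by (auto simp: ptd_add_def pinch_def flip_def fun_eq_iff)
  moreover have "pinch (K 1 x) = pole" for x
    by (rule pinch_eq_pole) (simp add: K_def)
  moreover have "pinch (K t pole) = pole" for t
    by (rule pinch_eq_pole) (simp add: K_def)
  ultimately show ?thesis
    using continuous_map_compose[OF K continuous_map_pinch[OF k]]
    unfolding ptd_homotopic_sph homotopic_with_def
    by (intro exI[of _ "pinch \<circ> (\<lambda>z. K (fst z) (snd z))"]) simp
qed

section \<open>Sums of homotopy classes\<close>

lemma continuous_map_cylinder_snd:
  assumes "continuous_map (nsphere k) (nsphere m) a"
  shows "continuous_map (prod_topology (top_of_set {0..1::real}) (nsphere k))
    (prod_topology (top_of_set {0..1}) (nsphere m)) (\<lambda>z. (fst z, a (snd z)))"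
  using continuous_map_compose[OF continuous_map_snd assms]
  by (simp add: continuous_map_pairwise o_def continuous_map_fst)

text \<open>The two homotopies are pasted along the equator, where \<open>pinch x\<close> is
  \<open>pole\<close> and both stay at the base point. This makes the sum of classes independent of
  representatives.\<close>

lemma ptd_homotopic_ptd_add:
  assumes k: "1 \<le> k" and f: "ptd_homotopic (sph k) X f f'" and g: "ptd_homotopic (sph k) X g g'"
  shows "ptd_homotopic (sph k) X (ptd_add f g) (ptd_add f' g')"
proof -
  let ?Z = "prod_topology (top_of_set {0..1::real}) (nsphere k)"
  obtain F where F: "continuous_map ?Z (fst X) F" "\<And>x. F (0, x) = f x" "\<And>x. F (1, x) = f' x"
    "\<And>t. t \<in> {0..1} \<Longrightarrow> F (t, pole) = snd X"
    using f unfolding ptd_homotopic_def homotopic_with_def by auto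
  obtain G where G: "continuous_map ?Z (fst X) G" "\<And>x. G (0, x) = g x" "\<And>x. G (1, x) = g' x"
    "\<And>t. t \<in> {0..1} \<Longrightarrow> G (t, pole) = snd X"
    using g unfolding ptd_homotopic_def homotopic_with_def by auto
  define H where "H z = (if 0 \<le> snd z 1 then F (fst z, pinch (snd z)) else G (fst z, pinch (snd z)))" for z
  note p = continuous_map_cylinder_snd[OF continuous_map_pinch[OF k]]
  have c: "continuous_map ?Z euclideanreal (\<lambda>z. snd z i)" for i
    using continuous_map_cylinder_nsphere[OF continuous_map_id] by simp
  have "continuous_map ?Z (fst X) H"
    unfolding H_def
  proof (rule continuous_map_cases_le)
    show "continuous_map (subtopology ?Z A) (fst X) (\<lambda>z. F (fst z, pinch (snd z)))"
      "continuous_map (subtopology ?Z A) (fst X) (\<lambda>z. G (fst z, pinch (snd z)))" for A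
      using continuous_map_compose[OF p F(1)] continuous_map_compose[OF p G(1)]
      by (simp_all add: o_def continuous_map_from_subtopology)
  qed (use c F(4) G(4) in \<open>auto simp: pinch_eq_pole\<close>)
  then show ?thesis
    unfolding ptd_homotopic_def homotopic_with_def
    by (intro exI[of _ H]) (auto simp: H_def F G ptd_add_def fun_eq_iff pinch_eq_pole)
qed

lemma homotopy_group_mult_hclass:
  assumes k: "1 \<le> k" and f: "ptd_map (sph k) X f" and g: "ptd_map (sph k) X g"
  shows "hclass (sph k) X f \<otimes>\<^bsub>homotopy_group k X\<^esub> hclass (sph k) X g = hclass (sph k) X (ptd_add f g)"
proof (intro Set.set_eqI iffI)
  fix h assume "h \<in> hclass (sph k) X f \<otimes>\<^bsub>homotopy_group k X\<^esub> hclass (sph k) X g"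
  then show "h \<in> hclass (sph k) X (ptd_add f g)"
    using ptd_homotopic_trans[OF ptd_homotopic_ptd_add[OF k, of X], of f _ g]
    by (auto simp: homotopy_group_def hclass_def)
next
  fix h assume "h \<in> hclass (sph k) X (ptd_add f g)"
  then show "h \<in> hclass (sph k) X f \<otimes>\<^bsub>homotopy_group k X\<^esub> hclass (sph k) X g"
    using ptd_homotopic_refl[OF f] ptd_homotopic_refl[OF g]
    by (auto simp: homotopy_group_def hclass_def)
qed

section \<open>Moving the middle summand between two quarters of the sphere\<close>

text \<open>The collapse \<open>upper\<close> turned by a quarter, so that it is supported in \<open>x\<^sub>0 \<le> 0\<close>.\<close>

definition swirl :: "(nat \<Rightarrow> real) \<Rightarrow> (nat \<Rightarrow> real)" where
  "swirl x = upper (\<lambda>i. if i = 0 then x 1 else if i = 1 then - x 0 else x i)"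

lemma swirl_pole: "0 \<le> x 0 \<Longrightarrow> swirl x = pole"
  by (auto simp: swirl_def upper_def ptd_add_def pinch_eq_pole)

text \<open>After the quarter turn, \<open>flip\<close> acts as a sign change in coordinate 0, which
  \<open>pinch\<close> converts into a sign change in its coordinate 1.\<close>

lemma flip_swirl: "flip (swirl x) = swirl (flip x)"
  by (auto simp: swirl_def upper_def ptd_add_def flip_def pinch_def pole_def)

lemma ptd_map_swirl:
  assumes k: "1 \<le> k"
  shows "ptd_map (sph k) (sph k) swirl"
proof -
  define r :: "(nat \<Rightarrow> real) \<Rightarrow> nat \<Rightarrow> real"
    where "r x = (\<lambda>i. if i = 0 then x 1 else if i = 1 then - x 0 else x i)" for x
  have "continuous_map (nsphere k) (nsphere k) r"
  proof (rule continuous_map_into_nsphere)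
    show "continuous_map (nsphere k) euclideanreal (\<lambda>z. r z i)" for i
      by (cases "i = 0"; cases "i = 1")
        (simp_all add: r_def continuous_map_nsphere_projection continuous_map_minus)
    show "r x \<in> topspace (nsphere k)" if "x \<in> topspace (nsphere k)" for x
    proof -
      have "(\<Sum>i\<in>{2..k}. (r x i)\<^sup>2) = (\<Sum>i\<in>{2..k}. (x i)\<^sup>2)"
        by (intro sum.cong) (auto simp: r_def)
      then show ?thesis
        using that k unfolding in_nsphere_01[OF k] by (auto simp: r_def)
    qed
  qed
  moreover have "continuous_map (nsphere k) (nsphere k) upper"
    using ptd_map_upper[OF k] by (simp add: ptd_map_def)
  moreover have "swirl = upper \<circ> r"
    by (simp add: swirl_def r_def fun_eq_iff)
  ultimately have "continuous_map (nsphere k) (nsphere k) swirl"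
    using continuous_map_compose by metis
  then show ?thesis
    by (simp add: ptd_map_def swirl_pole)
qed

text \<open>Both maps are constant outside the quarter \<open>x 0 \<le> 0\<close>,
  \<open>0 \<le> x 1\<close>; inside, each is \<open>pinch\<close> applied twice, the second one
  after a quarter turn. They are nowhere antipodal.\<close>

lemma lower_upper_homotopic_upper_swirl:
  assumes k: "1 \<le> k"
  shows "rel_homotopic k {x \<in> topspace (nsphere k). 0 \<le> x 0} (lower \<circ> upper) (upper \<circ> swirl)"
proof (rule rel_homotopic_not_antipodal)
  show "continuous_map (nsphere k) (nsphere k) (lower \<circ> upper)"
    "continuous_map (nsphere k) (nsphere k) (upper \<circ> swirl)"
    using ptd_map_upper[OF k] ptd_map_lower[OF k] ptd_map_swirl[OF k]
    by (auto simp: ptd_map_def intro: continuous_map_compose)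
  have pole: "upper pole = pole" "lower pole = pole"
    by (simp_all add: upper_def lower_def ptd_add_def pinch_eq_pole)
  show "(lower \<circ> upper) x = pole" "(upper \<circ> swirl) x = pole"
    if "x \<in> {x \<in> topspace (nsphere k). 0 \<le> x 0}" for x
    using that pole by (auto simp: swirl_pole upper_def lower_def ptd_add_def pinch_simps)
  fix x assume x: "x \<in> topspace (nsphere k)"
  show "\<exists>i. (lower \<circ> upper) x i \<noteq> - (upper \<circ> swirl) x i"
  proof (cases "0 \<le> x 0 \<or> x 1 < 0")
    case True
    then have "(lower \<circ> upper) x 0 = 1" "(upper \<circ> swirl) x 0 = 1"
      using pole by (auto simp: swirl_def upper_def lower_def ptd_add_def pinch_simps
          pinch_eq_pole mult_le_0_iff zero_le_mult_iff)
    then show ?thesis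
      by (intro exI[of _ 0]) simp
  next
    case False
    define X u where "X = x 0" and "u = x 1"
    have X: "X < 0" and u: "0 \<le> u"
      using False by (simp_all add: X_def u_def)
    define P Q where "P = (lower \<circ> upper) x" and "Q = (upper \<circ> swirl) x"
    have P: "P = pinch (pinch x)"
    proof (cases "u = 0")
      case True
      then show ?thesis
        by (simp add: P_def u_def upper_def lower_def ptd_add_def pinch_eq_pole)
    next
      case False
      then show ?thesis
        using X u by (auto simp: P_def X_def u_def upper_def lower_def ptd_add_def pinch_simps
            zero_le_mult_iff)
    qed
    have Q: "Q = pinch (pinch (\<lambda>i. if i = 0 then u else if i = 1 then - X else x i))"
      using X u unfolding Q_def X_def u_def
      by (auto simp: swirl_def upper_def ptd_add_def pinch_simps mult_le_0_iff)
    show ?thesis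
    proof (rule ccontr)
      assume "\<not> ?thesis"
      then have anti: "P i = - Q i" for i
        by (simp add: P_def Q_def)
      have P0: "P 0 = 1 - 8 * (X\<^sup>2 * u\<^sup>2)" and Q0: "Q 0 = 1 - 8 * (X\<^sup>2 * u\<^sup>2)"
        by (simp_all add: P Q pinch_simps X_def u_def power2_eq_square)
      have P1: "P 1 = 4 * (X * u) * (1 - 2 * u\<^sup>2)" and Q1: "Q 1 = - (4 * (X * u) * (1 - 2 * X\<^sup>2))"
        by (simp_all add: P Q pinch_simps X_def u_def)
      have Pi: "P i = 8 * \<bar>X\<bar> * u\<^sup>2 * x i" and Qi: "Q i = 8 * X\<^sup>2 * u * x i" if "2 \<le> i" for i
        using that u by (simp_all add: P Q pinch_simps X_def u_def abs_mult power2_eq_square)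
      \<comment> \<open>The equal coordinates 0 must vanish, which fixes the product at 1/8.
        Coordinates 1 give equal squares, and in the others the positive coefficients leave only
        \<open>x i = 0\<close>. On the resulting circle the product would be 1/4.\<close>
      have prod: "X\<^sup>2 * u\<^sup>2 = 1/8"
        using anti[of 0] P0 Q0 by simp
      then have nz: "X * u \<noteq> 0"
        by auto
      have "4 * (X * u) * (1 - 2 * u\<^sup>2) = 4 * (X * u) * (1 - 2 * X\<^sup>2)"
        using anti[of 1] by (simp only: P1 Q1 minus_minus)
      then have sq: "X\<^sup>2 = u\<^sup>2"
        using nz by simp
      have "x i = 0" if "i \<in> {2..k}" for i
      proof -
        have "(8 * \<bar>X\<bar> * u\<^sup>2 + 8 * X\<^sup>2 * u) * x i = 0"
          using anti[of i] Pi[of i] Qi[of i] that by (simp add: algebra_simps)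
        moreover have "8 * \<bar>X\<bar> * u\<^sup>2 + 8 * X\<^sup>2 * u > 0"
          using nz u by (intro add_pos_pos mult_pos_pos) auto
        ultimately show ?thesis
          by simp
      qed
      then have "X\<^sup>2 + u\<^sup>2 = 1"
        using x in_nsphere_01[OF k] by (simp add: X_def u_def)
      then have u2: "u\<^sup>2 = 1/2"
        using sq by simp
      show False
        using prod unfolding sq u2 by simp
    qed
  qed
qed auto

text \<open>The homotopy moves one quarter of the sphere to another inside the half \<open>x\<^sub>0 \<le> 0\<close>.\<close>

lemma lower_upper_homotopic_upper_lower:
  assumes k: "1 \<le> k"
  shows "rel_homotopic k {x \<in> topspace (nsphere k). 0 \<le> x 0} (lower \<circ> upper) (upper \<circ> lower)"
    (is "rel_homotopic k ?A _ _")
proof -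
  have swirl: "continuous_map (nsphere k) (nsphere k) swirl"
    using ptd_map_swirl[OF k] by (simp add: ptd_map_def)
  \<comment> \<open>\<open>swirl\<close> collapses the hemisphere \<open>?A\<close>, so a merely
    pointed homotopy precomposed with it is constant on all of \<open>?A\<close>.\<close>
  have swirl_const: "rel_homotopic k ?A (id \<circ> swirl) (a \<circ> swirl)"
    if "ptd_homotopic (sph k) (sph k) id a" for a
    using that unfolding ptd_homotopic_sph
    by (rule homotopic_with_compose_continuous_map_right[OF _ swirl]) (simp add: swirl_pole)
  \<comment> \<open>Conjugation by \<open>flip\<close> preserves \<open>?A\<close> and gives a
    homotopy between \<open>upper \<circ> lower\<close> and \<open>lower \<circ> swirl\<close>. The
    latter is joined to \<open>upper \<circ> swirl\<close> through \<open>swirl\<close>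
    itself.\<close>
  have "rel_homotopic k ?A ((flip \<circ> (lower \<circ> upper)) \<circ> flip) ((flip \<circ> (upper \<circ> swirl)) \<circ> flip)"
  proof (rule homotopic_with_compose_continuous_map_right[OF _ continuous_map_flip])
    show "rel_homotopic k ?A (flip \<circ> (lower \<circ> upper)) (flip \<circ> (upper \<circ> swirl))"
      by (rule homotopic_with_compose_continuous_map_left
          [OF lower_upper_homotopic_upper_swirl[OF k] continuous_map_flip]) simp
    show "\<forall>x\<in>?A. (j \<circ> flip) x = pole" if "\<forall>x\<in>?A. j x = pole" for j
      using that in_nsphere_flip by (auto simp: flip_def)
  qed
  moreover have "(flip \<circ> (lower \<circ> upper)) \<circ> flip = (flip \<circ> lower \<circ> flip) \<circ> (flip \<circ> upper \<circ> flip)"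
    "(flip \<circ> (upper \<circ> swirl)) \<circ> flip = (flip \<circ> upper \<circ> flip) \<circ> swirl"
    by (simp_all add: fun_eq_iff flip_swirl)
  then have "(flip \<circ> (lower \<circ> upper)) \<circ> flip = upper \<circ> lower"
    "(flip \<circ> (upper \<circ> swirl)) \<circ> flip = lower \<circ> swirl"
    by (simp_all only: flip_upper_flip flip_lower_flip)
  ultimately have 1: "rel_homotopic k ?A (upper \<circ> lower) (lower \<circ> swirl)"
    by simp
  have 2: "rel_homotopic k ?A (upper \<circ> swirl) (lower \<circ> swirl)"
    using homotopic_with_trans[OF homotopic_with_symD[OF swirl_const[OF ptd_homotopic_id_upper[OF k]]]
        swirl_const[OF ptd_homotopic_id_lower[OF k]]] .
  show ?thesis
    using homotopic_with_trans[OF lower_upper_homotopic_upper_swirl[OF k]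
        homotopic_with_trans[OF 2 homotopic_with_symD[OF 1]]] .
qed

text \<open>Only the part on \<open>x 0 < 0\<close> moves, along the homotopy from \<open>a\<close>
  to \<open>b\<close>. On \<open>x 0 = 0\<close> that homotopy stays at \<open>pole\<close> and
  \<open>E\<close> at the base point, so the pieces match.\<close>

lemma ptd_homotopic_glue:
  assumes E: "ptd_map (sph k) X E" and E0: "\<And>x. x \<in> topspace (nsphere k) \<Longrightarrow> x 0 = 0 \<Longrightarrow> E x = snd X"
    and g: "ptd_map (sph k) X g"
    and ab: "rel_homotopic k {x \<in> topspace (nsphere k). 0 \<le> x 0} a b"
  shows "ptd_homotopic (sph k) X (\<lambda>x. if 0 \<le> x 0 then E x else g (a x))
    (\<lambda>x. if 0 \<le> x 0 then E x else g (b x))"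
proof -
  let ?Z = "prod_topology (top_of_set {0..1::real}) (nsphere k)"
  obtain h where h: "continuous_map ?Z (nsphere k) h" "\<And>x. h (0, x) = a x" "\<And>x. h (1, x) = b x"
    "\<And>t x. t \<in> {0..1} \<Longrightarrow> x \<in> topspace (nsphere k) \<Longrightarrow> 0 \<le> x 0 \<Longrightarrow> h (t, x) = pole"
    using ab unfolding homotopic_with_def by auto
  define H where "H z = (if 0 \<le> snd z 0 then E (snd z) else g (h z))" for z
  have c: "continuous_map ?Z euclideanreal (\<lambda>z. snd z i)" for i
    using continuous_map_cylinder_nsphere[OF continuous_map_id] by simp
  have "continuous_map ?Z (fst X) H"
    unfolding H_def
  proof (rule continuous_map_cases_le)
    have "continuous_map ?Z (fst X) (E \<circ> snd)"
      using E by (intro continuous_map_compose[OF continuous_map_snd]) (simp add: ptd_map_def)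
    moreover have "continuous_map ?Z (fst X) (g \<circ> h)"
      using g by (intro continuous_map_compose[OF h(1)]) (simp add: ptd_map_def)
    ultimately show "continuous_map (subtopology ?Z A) (fst X) (\<lambda>z. E (snd z))"
      "continuous_map (subtopology ?Z A) (fst X) (\<lambda>z. g (h z))" for A
      by (simp_all add: o_def continuous_map_from_subtopology)
  qed (use c E0 g h(4) in \<open>auto simp: ptd_map_def\<close>)
  then show ?thesis
    using E unfolding ptd_homotopic_def homotopic_with_def
    by (intro exI[of _ H]) (auto simp: H_def h ptd_map_def)
qed

section \<open>The group laws\<close>

lemma ptd_homotopic_ptd_add_const:
  assumes k: "1 \<le> k" and f: "ptd_map (sph k) X f"
  shows "ptd_homotopic (sph k) X (ptd_add f (\<lambda>_. snd X)) f"
    and "ptd_homotopic (sph k) X (ptd_add (\<lambda>_. snd X) f) f"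
proof -
  have "ptd_add f (\<lambda>_. snd X) = f \<circ> upper" "ptd_add (\<lambda>_. snd X) f = f \<circ> lower"
    using f by (auto simp: upper_def lower_def ptd_add_def ptd_map_def fun_eq_iff)
  then show "ptd_homotopic (sph k) X (ptd_add f (\<lambda>_. snd X)) f"
    "ptd_homotopic (sph k) X (ptd_add (\<lambda>_. snd X) f) f"
    using ptd_homotopic_compose_left[OF ptd_homotopic_id_upper[OF k] f]
      ptd_homotopic_compose_left[OF ptd_homotopic_id_lower[OF k] f]
    by (simp_all add: ptd_homotopic_sym)
qed

lemma ptd_homotopic_ptd_add_assoc:
  assumes k: "1 \<le> k" and f: "ptd_map (sph k) X f" and g: "ptd_map (sph k) X g" and h: "ptd_map (sph k) X h"
    and X: "ptd_space X"
  shows "ptd_homotopic (sph k) X (ptd_add (ptd_add f g) h) (ptd_add f (ptd_add g h))"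
proof -
  let ?c = "\<lambda>_. snd X"
  \<comment> \<open>The common part of the two sums in the interchange: it carries \<open>f\<close>
    and \<open>h\<close> on the two quarters of \<open>0 \<le> x 0\<close>, while \<open>g\<close>
    is confined to \<open>x 0 \<le> 0\<close>.\<close>
  define E where "E = ptd_add (ptd_add f ?c) (ptd_add ?c h)"
  have base: "f pole = snd X" "g pole = snd X" "h pole = snd X"
    using f g h by (simp_all add: ptd_map_def)
  note maps = ptd_map_ptd_add[OF k] ptd_map_const[OF X, of "sph k"]
  have E: "ptd_map (sph k) X E"
    unfolding E_def by (intro maps f h)
  have E0: "E x = snd X" if "x 0 = 0" for x
    using that base by (simp add: E_def ptd_add_def pinch_simps pinch_eq_pole[of "pinch x"])
  \<comment> \<open>The inner sums branch on the sign of \<open>2 * x 1 * x 0\<close>, so the sign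
    of \<open>x 0\<close> acts in reverse for \<open>x 1 < 0\<close>. For \<open>x 1 = 0\<close>
    everything is at the base point.\<close>
  have split: "ptd_add a b x = (if 0 \<le> x 0 then E x else g (d x))"
    if "a = ptd_add f g \<and> b = ptd_add ?c h \<and> d = lower \<circ> upper
      \<or> a = ptd_add f ?c \<and> b = ptd_add g h \<and> d = upper \<circ> lower" for a b d x
  proof -
    consider "x 1 = 0" | "x 1 < 0" | "x 1 > 0"
      by linarith
    then show ?thesis
    proof cases
      case 1
      then show ?thesis
        using that base
        by (auto simp: E_def ptd_add_def upper_def lower_def pinch_eq_pole)
    next
      case 2
      then show ?thesis
        using that base
        by (auto simp: E_def ptd_add_def upper_def lower_def pinch_eq_pole pinch_simps
            zero_le_mult_iff mult_le_0_iff)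
    next
      case 3
      then show ?thesis
        using that base
        by (auto simp: E_def ptd_add_def upper_def lower_def pinch_eq_pole pinch_simps
            zero_le_mult_iff mult_le_0_iff)
    qed
  qed
  have "ptd_add (ptd_add f g) (ptd_add ?c h) = (\<lambda>x. if 0 \<le> x 0 then E x else g ((lower \<circ> upper) x))"
    "ptd_add (ptd_add f ?c) (ptd_add g h) = (\<lambda>x. if 0 \<le> x 0 then E x else g ((upper \<circ> lower) x))"
    using split by blast+
  then have interchange: "ptd_homotopic (sph k) X (ptd_add (ptd_add f g) (ptd_add ?c h))
      (ptd_add (ptd_add f ?c) (ptd_add g h))"
    using ptd_homotopic_glue[OF E E0 g lower_upper_homotopic_upper_lower[OF k]] by (simp only:)
  have "ptd_homotopic (sph k) X (ptd_add (ptd_add f g) h) (ptd_add (ptd_add f g) (ptd_add ?c h))"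
    by (intro ptd_homotopic_ptd_add k ptd_homotopic_refl maps f g
        ptd_homotopic_sym[OF ptd_homotopic_ptd_add_const(2)] h)
  moreover note interchange
  moreover have "ptd_homotopic (sph k) X (ptd_add (ptd_add f ?c) (ptd_add g h)) (ptd_add f (ptd_add g h))"
    by (intro ptd_homotopic_ptd_add k ptd_homotopic_refl maps g h
        ptd_homotopic_ptd_add_const(1) f)
  ultimately show ?thesis
    by (blast intro: ptd_homotopic_trans)
qed

theorem group_homotopy_group:
  assumes k: "1 \<le> k" and X: "ptd_space X"
  shows "group (homotopy_group k X)"
proof -
  let ?\<pi> = "homotopy_group k X" and ?cl = "hclass (sph k) X"
  have carrE: "\<exists>f. ptd_map (sph k) X f \<and> F = ?cl f" if "F \<in> carrier ?\<pi>" for F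
    using that by (auto simp: homotopy_group_def hmor_def)
  have cl: "?cl f \<in> carrier ?\<pi>" if "ptd_map (sph k) X f" for f
    using that by (simp add: homotopy_group_def hclass_in_hmor)
  have one: "\<one>\<^bsub>?\<pi>\<^esub> = ?cl (\<lambda>_. snd X)"
    by (simp add: homotopy_group_def)
  have const: "ptd_map (sph k) X (\<lambda>_. snd X)"
    using X by (rule ptd_map_const)
  note mult = homotopy_group_mult_hclass[OF k] and add = ptd_map_ptd_add[OF k]
  show ?thesis
  proof (rule groupI)
    fix F G assume "F \<in> carrier ?\<pi>" "G \<in> carrier ?\<pi>"
    then obtain f g where "ptd_map (sph k) X f" "F = ?cl f" "ptd_map (sph k) X g" "G = ?cl g"
      using carrE by meson
    then show "F \<otimes>\<^bsub>?\<pi>\<^esub> G \<in> carrier ?\<pi>"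
      using cl[OF add] by (simp add: mult)
  next
    show "\<one>\<^bsub>?\<pi>\<^esub> \<in> carrier ?\<pi>"
      using cl[OF const] one by simp
  next
    fix F G H assume "F \<in> carrier ?\<pi>" "G \<in> carrier ?\<pi>" "H \<in> carrier ?\<pi>"
    then obtain f g h where "ptd_map (sph k) X f" "F = ?cl f" "ptd_map (sph k) X g" "G = ?cl g"
      "ptd_map (sph k) X h" "H = ?cl h"
      using carrE by meson
    then show "F \<otimes>\<^bsub>?\<pi>\<^esub> G \<otimes>\<^bsub>?\<pi>\<^esub> H = F \<otimes>\<^bsub>?\<pi>\<^esub> (G \<otimes>\<^bsub>?\<pi>\<^esub> H)"
      using ptd_homotopic_ptd_add_assoc[OF k _ _ _ X] by (simp add: mult add hclass_eq_iff)
  next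
    fix F assume "F \<in> carrier ?\<pi>"
    then obtain f where f: "ptd_map (sph k) X f" "F = ?cl f"
      using carrE by blast
    show "\<one>\<^bsub>?\<pi>\<^esub> \<otimes>\<^bsub>?\<pi>\<^esub> F = F"
      using f const ptd_homotopic_ptd_add_const(2)[OF k f(1)] by (simp add: one mult add hclass_eq_iff)
    \<comment> \<open>This represents the inverse of \<open>f\<close>: as \<open>flip\<close> is an
      involution, \<open>ptd_add (f \<circ> flip) f\<close> is \<open>f \<circ> flip\<close> after
      the null-homotopic \<open>ptd_add id flip\<close>.\<close>
    have ff: "ptd_map (sph k) X (f \<circ> flip)"
      using ptd_map_compose[OF ptd_map_flip f(1)] .
    have "ptd_homotopic (sph k) X ((f \<circ> flip) \<circ> ptd_add id flip) ((f \<circ> flip) \<circ> (\<lambda>_. pole))"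
      using ptd_homotopic_compose_left[OF ptd_homotopic_ptd_add_flip[OF k] ff] .
    moreover have "(f \<circ> flip) \<circ> ptd_add id flip = ptd_add (f \<circ> flip) f"
      by (simp add: ptd_add_def fun_eq_iff)
    moreover have "(f \<circ> flip) \<circ> (\<lambda>_::nat \<Rightarrow> real. pole) = (\<lambda>_. snd X)"
      using f by (simp add: ptd_map_def fun_eq_iff)
    ultimately have "ptd_homotopic (sph k) X (ptd_add (f \<circ> flip) f) (\<lambda>_. snd X)"
      by (simp only:)
    then have "?cl (f \<circ> flip) \<otimes>\<^bsub>?\<pi>\<^esub> F = \<one>\<^bsub>?\<pi>\<^esub>"
      using f ff by (simp add: one mult add hclass_eq_iff)
    then show "\<exists>G\<in>carrier ?\<pi>. G \<otimes>\<^bsub>?\<pi>\<^esub> F = \<one>\<^bsub>?\<pi>\<^esub>"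
      using cl[OF ff] by blast
  qed
qed

section \<open>Induced homomorphisms of homotopy groups\<close>

lemma ptd_add_compose: "h \<circ> ptd_add f g = ptd_add (h \<circ> f) (h \<circ> g)"
  by (simp add: ptd_add_def fun_eq_iff)

lemma hcomp_hom:
  assumes k: "1 \<le> k" and U: "U \<in> hmor X Y"
  shows "hcomp (sph k) Y U \<in> hom (homotopy_group k X) (homotopy_group k Y)"
proof (rule homI)
  obtain u where u: "ptd_map X Y u" "U = hclass X Y u"
    using U by (rule hmorE)
  show "hcomp (sph k) Y U F \<in> carrier (homotopy_group k Y)"
    if "F \<in> carrier (homotopy_group k X)" for F
    using that U hcomp_in_hmor by (simp add: homotopy_group_def)
  fix F G assume "F \<in> carrier (homotopy_group k X)" "G \<in> carrier (homotopy_group k X)"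
  then obtain f g where fg: "ptd_map (sph k) X f" "F = hclass (sph k) X f"
    "ptd_map (sph k) X g" "G = hclass (sph k) X g"
    by (auto simp: homotopy_group_def elim!: hmorE)
  show "hcomp (sph k) Y U (F \<otimes>\<^bsub>homotopy_group k X\<^esub> G)
      = hcomp (sph k) Y U F \<otimes>\<^bsub>homotopy_group k Y\<^esub> hcomp (sph k) Y U G"
    using fg u k
    by (simp add: homotopy_group_mult_hclass hcomp_hclass ptd_map_ptd_add ptd_map_compose ptd_add_compose)
qed


section \<open>Shape groups and expansions\<close>

lemma HPol_systemD:
  assumes "HPol_system S"
  shows "Idx S \<noteq> {}"
    and "\<And>i. i \<in> Idx S \<Longrightarrow> Leq S i i"
    and "\<And>i j k. i \<in> Idx S \<Longrightarrow> j \<in> Idx S \<Longrightarrow> k \<in> Idx S \<Longrightarrow> Leq S i j \<Longrightarrow> Leq S j k \<Longrightarrow> Leq S i k"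
    and "\<And>i j. i \<in> Idx S \<Longrightarrow> j \<in> Idx S \<Longrightarrow> \<exists>k\<in>Idx S. Leq S i k \<and> Leq S j k"
    and "\<And>i. i \<in> Idx S \<Longrightarrow> HPol (Obj S i)"
    and "\<And>i j. i \<in> Idx S \<Longrightarrow> j \<in> Idx S \<Longrightarrow> Leq S i j \<Longrightarrow> Bond S i j \<in> hmor (Obj S j) (Obj S i)"
    and "\<And>i j k. i \<in> Idx S \<Longrightarrow> j \<in> Idx S \<Longrightarrow> k \<in> Idx S \<Longrightarrow> Leq S i j \<Longrightarrow> Leq S j k \<Longrightarrow>
        hcomp (Obj S k) (Obj S i) (Bond S i j) (Bond S j k) = Bond S i k"
  using assms unfolding HPol_system_def directed_set_def by blast+

lemma HPol_expansionD:
  fixes X :: "'u ptd"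
  assumes "HPol_expansion X S p"
  shows "HPol_system S"
    and "\<And>i. i \<in> Idx S \<Longrightarrow> p i \<in> hmor X (Obj S i)"
    and "\<And>i j. i \<in> Idx S \<Longrightarrow> j \<in> Idx S \<Longrightarrow> Leq S i j \<Longrightarrow> hcomp X (Obj S i) (Bond S i j) (p j) = p i"
    and "\<And>(P :: 'u ptd) h. HPol P \<Longrightarrow> h \<in> hmor X P \<Longrightarrow> \<exists>i\<in>Idx S. \<exists>f\<in>hmor (Obj S i) P. hcomp X P f (p i) = h"
    and "\<And>(P :: 'u ptd) i f g. HPol P \<Longrightarrow> i \<in> Idx S \<Longrightarrow> f \<in> hmor (Obj S i) P \<Longrightarrow> g \<in> hmor (Obj S i) P \<Longrightarrow>
        hcomp X P f (p i) = hcomp X P g (p i) \<Longrightarrow>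
        \<exists>j\<in>Idx S. Leq S i j \<and> hcomp (Obj S j) P f (Bond S i j) = hcomp (Obj S j) P g (Bond S i j)"
proof -
  note d = assms[unfolded HPol_expansion_def]
  show "HPol_system S"
    using d by (rule conjunct1)
  note d = d[THEN conjunct2]
  show "\<And>i. i \<in> Idx S \<Longrightarrow> p i \<in> hmor X (Obj S i)"
    using d by (elim conjunct1[THEN bspec])
  note d = d[THEN conjunct2]
  show "\<And>i j. i \<in> Idx S \<Longrightarrow> j \<in> Idx S \<Longrightarrow> Leq S i j \<Longrightarrow> hcomp X (Obj S i) (Bond S i j) (p j) = p i"
    using d[THEN conjunct1] by meson
  note d = d[THEN conjunct2]
  show "\<And>(P :: 'u ptd) h. HPol P \<Longrightarrow> h \<in> hmor X P \<Longrightarrow> \<exists>i\<in>Idx S. \<exists>f\<in>hmor (Obj S i) P. hcomp X P f (p i) = h"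
    using d[THEN conjunct1] by meson
  note d = d[THEN conjunct2]
  show "\<And>(P :: 'u ptd) i f g. HPol P \<Longrightarrow> i \<in> Idx S \<Longrightarrow> f \<in> hmor (Obj S i) P \<Longrightarrow> g \<in> hmor (Obj S i) P \<Longrightarrow>
        hcomp X P f (p i) = hcomp X P g (p i) \<Longrightarrow>
        \<exists>j\<in>Idx S. Leq S i j \<and> hcomp (Obj S j) P f (Bond S i j) = hcomp (Obj S j) P g (Bond S i j)"
    using d by meson
qed

section \<open>Shape morphisms, and discreteness for polyhedral spaces\<close>

lemma shape_morD:
  assumes "F \<in> shape_mor k S"
  shows "\<And>i. i \<in> Idx S \<Longrightarrow> F i \<in> hmor (sph k) (Obj S i)"
    and "\<And>i j. i \<in> Idx S \<Longrightarrow> j \<in> Idx S \<Longrightarrow> Leq S i j \<Longrightarrow> hcomp (sph k) (Obj S i) (Bond S i j) (F j) = F i"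
    and "F \<in> extensional (Idx S)"
  using assms by (auto simp: shape_mor_def PiE_def)

lemma shape_mor_eqI:
  assumes "F \<in> shape_mor k S" "G \<in> shape_mor k S" "\<And>i. i \<in> Idx S \<Longrightarrow> F i = G i"
  shows "F = G"
  using assms by (meson extensionalityI shape_morD(3))

text \<open>
  Well-definedness of the composition of a shape morphism with a morphism represented at two
  different stages of the expansion.
\<close>

lemma shape_mor_hcomp_cong:
  fixes X P :: "'u ptd"
  assumes S: "HPol_expansion X S p" and P: "HPol P" and F: "F \<in> shape_mor k S"
    and i: "i \<in> Idx S" and j: "j \<in> Idx S"
    and f: "f \<in> hmor (Obj S i) P" and g: "g \<in> hmor (Obj S j) P"
    and eq: "hcomp X P f (p i) = hcomp X P g (p j)"
  shows "hcomp (sph k) P f (F i) = hcomp (sph k) P g (F j)"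
proof -
  note exp = HPol_expansionD[OF S]
  note sys = HPol_systemD[OF exp(1)]
  \<comment> \<open>Both morphisms are moved to a common index \<open>l\<close>. They still agree
    after \<open>p l\<close>, so (E2) supplies a later index \<open>m\<close> at which they become
    equal.\<close>
  obtain l where l: "l \<in> Idx S" "Leq S i l" "Leq S j l"
    using sys(4)[OF i j] by blast
  have push: "hcomp (sph k) P a (F n) = hcomp (sph k) P (hcomp (Obj S m) P a (Bond S n m)) (F m)"
    if "n \<in> Idx S" "m \<in> Idx S" "Leq S n m" "a \<in> hmor (Obj S n) P" for n m a
    using hcomp_assoc[OF shape_morD(1)[OF F that(2)] sys(6)[OF that(1-3)] that(4)]
      shape_morD(2)[OF F that(1-3)] by simp
  define f' g' where "f' = hcomp (Obj S l) P f (Bond S i l)" and "g' = hcomp (Obj S l) P g (Bond S j l)"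
  have f': "f' \<in> hmor (Obj S l) P" and g': "g' \<in> hmor (Obj S l) P"
    unfolding f'_def g'_def using l i j f g sys(6) by (blast intro: hcomp_in_hmor)+
  have "hcomp X P f' (p l) = hcomp X P f (p i)" "hcomp X P g' (p l) = hcomp X P g (p j)"
    using hcomp_assoc[OF exp(2)[OF l(1)] sys(6)[OF i l(1,2)] f] exp(3)[OF i l(1,2)]
      hcomp_assoc[OF exp(2)[OF l(1)] sys(6)[OF j l(1,3)] g] exp(3)[OF j l(1,3)]
    by (simp_all add: f'_def g'_def)
  then obtain m where m: "m \<in> Idx S" "Leq S l m"
    "hcomp (Obj S m) P f' (Bond S l m) = hcomp (Obj S m) P g' (Bond S l m)"
    using exp(5)[OF P l(1) f' g'] eq by auto
  have "hcomp (sph k) P f (F i) = hcomp (sph k) P f' (F l)"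
    unfolding f'_def using push l i f by blast
  also have "\<dots> = hcomp (sph k) P g' (F l)"
    using push[OF l(1) m(1,2)] f' g' m(3) by simp
  also have "\<dots> = hcomp (sph k) P g (F j)"
    unfolding g'_def using push[OF j l(1,3) g] by simp
  finally show ?thesis .
qed

text \<open>(E1) applied to the identity, possible because \<open>X\<close> is itself a test
  object.\<close>

lemma HPol_expansion_retraction:
  fixes X :: "'u ptd"
  assumes "HPol_expansion X S p" "HPol X"
  obtains i f where "i \<in> Idx S" "f \<in> hmor (Obj S i) X" "hcomp X X f (p i) = hid X"
  using HPol_expansionD(4)[OF assms hid_in_hmor] by blast

text \<open>The composite of \<open>p j\<close> and \<open>f\<close> at stage \<open>i\<close> and
  the identity at stage \<open>j\<close> both represent \<open>p j\<close>, so they take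
  \<open>F\<close> to the same class.\<close>

lemma shape_mor_determined:
  fixes X :: "'u ptd"
  assumes S: "HPol_expansion X S p" and i: "i \<in> Idx S" and f: "f \<in> hmor (Obj S i) X"
    and retr: "hcomp X X f (p i) = hid X" and F: "F \<in> shape_mor k S" and j: "j \<in> Idx S"
  shows "hcomp (sph k) (Obj S j) (p j) (hcomp (sph k) X f (F i)) = F j"
proof -
  note exp = HPol_expansionD[OF S]
  note sys = HPol_systemD[OF exp(1)]
  have pj: "p j \<in> hmor X (Obj S j)" and pi: "p i \<in> hmor X (Obj S i)"
    using i j exp(2) by auto
  have "hcomp X (Obj S j) (hcomp (Obj S i) (Obj S j) (p j) f) (p i) = hcomp X (Obj S j) (p j) (hid X)"
    using hcomp_assoc[OF pi f pj] retr by simp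
  also have "\<dots> = p j"
    using pj by (elim hmorE) (simp add: hid_def hcomp_hclass[OF ptd_map_id])
  also have "\<dots> = hcomp X (Obj S j) (hid (Obj S j)) (p j)"
    using pj by (simp add: hcomp_hid_left)
  finally have "hcomp (sph k) (Obj S j) (hcomp (Obj S i) (Obj S j) (p j) f) (F i)
      = hcomp (sph k) (Obj S j) (hid (Obj S j)) (F j)"
    by (intro shape_mor_hcomp_cong[OF S sys(5)[OF j] F i j] hcomp_in_hmor[OF f pj] hid_in_hmor)
  then show ?thesis
    using hcomp_assoc[OF shape_morD(1)[OF F i] f pj] hcomp_hid_left[OF shape_morD(1)[OF F j]] by simp
qed

theorem HPol_shape_group_discrete:
  fixes X :: "'u ptd"
  assumes "HPol X" and S: "HPol_expansion X S p"
  shows "shape_group_discrete k S"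
proof -
  obtain i f where i: "i \<in> Idx S" and f: "f \<in> hmor (Obj S i) X" and retr: "hcomp X X f (p i) = hid X"
    using HPol_expansion_retraction[OF S assms(1)] by blast
  have det: "F = G" if "F \<in> shape_mor k S" "G \<in> shape_mor k S" "F i = G i" for F G
  proof (rule shape_mor_eqI[OF that(1,2)])
    show "F j = G j" if "j \<in> Idx S" for j
      using shape_mor_determined[OF S i f retr] that \<open>F \<in> _\<close> \<open>G \<in> _\<close> \<open>F i = G i\<close> by metis
  qed
  show ?thesis
    unfolding shape_group_discrete_def topology_eq
  proof (intro allI)
    fix U
    \<comment> \<open>By \<open>det\<close> the basic neighbourhoods at stage \<open>i\<close> are
      single points.\<close>
    have "shape_nbhd k S i F \<subseteq> U" if "F \<in> U" "U \<subseteq> shape_mor k S" for F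
      using that det by (auto simp: shape_nbhd_def)
    then show "openin (shape_topology k S) U \<longleftrightarrow> openin (discrete_topology (shape_mor k S)) U"
      using i unfolding openin_shape_topology[OF HPol_expansionD(1)[OF S]] by auto
  qed
qed

section \<open>Shape groups as inverse limits of groups\<close>

lemma HPol_imp_ptd_space: "HPol X \<Longrightarrow> ptd_space X"
  by (simp add: HPol_def)

text \<open>The laws hold stage by stage; compatible families are closed under the operations
  because the bonding morphisms induce homomorphisms.\<close>

lemma group_shape_group:
  assumes k: "1 \<le> k" and S: "HPol_system S"
  shows "group (shape_group k S)"
proof -
  note sys = HPol_systemD[OF S]
  let ?\<pi> = "\<lambda>i. homotopy_group k (Obj S i)"
  have grp: "group (?\<pi> i)" if "i \<in> Idx S" for i
    using that k sys(5) by (intro group_homotopy_group HPol_imp_ptd_space)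
  have carr: "carrier (?\<pi> i) = hmor (sph k) (Obj S i)" for i
    by (simp add: homotopy_group_def)
  have bond: "group_hom (?\<pi> j) (?\<pi> i) (hcomp (sph k) (Obj S i) (Bond S i j))"
    if "i \<in> Idx S" "j \<in> Idx S" "Leq S i j" for i j
    using that grp hcomp_hom[OF k sys(6)] by (simp add: group_hom_def group_hom_axioms_def)
  have comp: "F i \<in> carrier (?\<pi> i)" if "F \<in> shape_mor k S" "i \<in> Idx S" for F i
    using shape_morD(1)[OF that] carr by simp
  have memI: "(\<lambda>i\<in>Idx S. a i) \<in> shape_mor k S"
    if "\<And>i. i \<in> Idx S \<Longrightarrow> a i \<in> carrier (?\<pi> i)"
      "\<And>i j. i \<in> Idx S \<Longrightarrow> j \<in> Idx S \<Longrightarrow> Leq S i j \<Longrightarrow> hcomp (sph k) (Obj S i) (Bond S i j) (a j) = a i"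
    for a
    using that carr by (auto simp: shape_mor_def)
  show ?thesis
  proof (rule groupI)
    fix F G assume "F \<in> carrier (shape_group k S)" "G \<in> carrier (shape_group k S)"
    then have FG: "F \<in> shape_mor k S" "G \<in> shape_mor k S"
      by (simp_all add: shape_group_def)
    show "F \<otimes>\<^bsub>shape_group k S\<^esub> G \<in> carrier (shape_group k S)"
      unfolding shape_group_def monoid.simps partial_object.simps
    proof (rule memI)
      show "F i \<otimes>\<^bsub>?\<pi> i\<^esub> G i \<in> carrier (?\<pi> i)" if "i \<in> Idx S" for i
        using that comp FG grp by (simp add: group.is_monoid monoid.m_closed)
      show "hcomp (sph k) (Obj S i) (Bond S i j) (F j \<otimes>\<^bsub>?\<pi> j\<^esub> G j) = F i \<otimes>\<^bsub>?\<pi> i\<^esub> G i"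
        if "i \<in> Idx S" "j \<in> Idx S" "Leq S i j" for i j
        using group_hom.hom_mult[OF bond[OF that] comp[OF FG(1) that(2)] comp[OF FG(2) that(2)]]
          shape_morD(2)[OF FG(1) that] shape_morD(2)[OF FG(2) that] by simp
    qed
  next
    show "\<one>\<^bsub>shape_group k S\<^esub> \<in> carrier (shape_group k S)"
      unfolding shape_group_def monoid.simps partial_object.simps
      by (rule memI) (use grp bond in \<open>simp_all add: group.is_monoid group_hom.hom_one\<close>)
  next
    fix F G H assume "F \<in> carrier (shape_group k S)" "G \<in> carrier (shape_group k S)"
      "H \<in> carrier (shape_group k S)"
    then have "F i \<in> carrier (?\<pi> i)" "G i \<in> carrier (?\<pi> i)" "H i \<in> carrier (?\<pi> i)" if "i \<in> Idx S" for i
      using that comp by (simp_all add: shape_group_def)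
    then show "F \<otimes>\<^bsub>shape_group k S\<^esub> G \<otimes>\<^bsub>shape_group k S\<^esub> H
        = F \<otimes>\<^bsub>shape_group k S\<^esub> (G \<otimes>\<^bsub>shape_group k S\<^esub> H)"
      using grp by (auto simp: shape_group_def group.is_monoid monoid.m_assoc intro!: restrict_ext)
  next
    fix F assume "F \<in> carrier (shape_group k S)"
    then have F: "F \<in> shape_mor k S"
      by (simp add: shape_group_def)
    show "\<one>\<^bsub>shape_group k S\<^esub> \<otimes>\<^bsub>shape_group k S\<^esub> F = F"
      using comp[OF F] grp shape_morD(3)[OF F]
      by (auto simp: shape_group_def group.is_monoid monoid.l_one fun_eq_iff extensional_def)
    let ?G = "\<lambda>i\<in>Idx S. inv\<^bsub>?\<pi> i\<^esub> (F i)"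
    have mem: "?G \<in> shape_mor k S"
    proof (rule memI)
      show "inv\<^bsub>?\<pi> i\<^esub> (F i) \<in> carrier (?\<pi> i)" if "i \<in> Idx S" for i
        using that comp F grp by simp
      show "hcomp (sph k) (Obj S i) (Bond S i j) (inv\<^bsub>?\<pi> j\<^esub> (F j)) = inv\<^bsub>?\<pi> i\<^esub> (F i)"
        if "i \<in> Idx S" "j \<in> Idx S" "Leq S i j" for i j
        using group_hom.hom_inv[OF bond[OF that] comp[OF F that(2)]] shape_morD(2)[OF F that] by simp
    qed
    have "?G \<otimes>\<^bsub>shape_group k S\<^esub> F = \<one>\<^bsub>shape_group k S\<^esub>"
      using comp[OF F] grp by (auto simp: shape_group_def group.l_inv intro!: restrict_ext)
    moreover have "?G \<in> carrier (shape_group k S)"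
      using mem by (simp add: shape_group_def)
    ultimately show "\<exists>G\<in>carrier (shape_group k S). G \<otimes>\<^bsub>shape_group k S\<^esub> F = \<one>\<^bsub>shape_group k S\<^esub>"
      by blast
  qed
qed

section \<open>Embedding a discrete shape group into that of a stage\<close>

lemma shape_group_simps:
  "carrier (shape_group k S) = shape_mor k S"
  "i \<in> Idx S \<Longrightarrow> (F \<otimes>\<^bsub>shape_group k S\<^esub> G) i = F i \<otimes>\<^bsub>homotopy_group k (Obj S i)\<^esub> G i"
  "i \<in> Idx S \<Longrightarrow> \<one>\<^bsub>shape_group k S\<^esub> i = \<one>\<^bsub>homotopy_group k (Obj S i)\<^esub>"
  by (simp_all add: shape_group_def)

lemma top_group_embeds_discrete:
  assumes "group_hom G H \<phi>" and inj: "inj_on \<phi> (carrier G)"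
    and T: "T = discrete_topology (carrier G)" and U: "U = discrete_topology (carrier H)"
  shows "top_group_embeds G T H U"
  unfolding top_group_embeds_def
proof (intro exI conjI bexI)
  interpret group_hom G H \<phi> by fact
  have img: "\<phi> ` carrier G \<subseteq> carrier H"
    by auto
  show "subgroup (\<phi> ` carrier G) H"
    by (rule img_is_subgroup)
  show "\<phi> \<in> iso G (H\<lparr>carrier := \<phi> ` carrier G\<rparr>)"
    using inj by (auto simp: iso_def hom_def bij_betw_def)
  have "subtopology U (\<phi> ` carrier G) = discrete_topology (\<phi> ` carrier G)"
    using img by (simp add: U subtopology_discrete_topology Int_absorb1)
  moreover have "homeomorphic_map (discrete_topology (carrier G)) (discrete_topology (\<phi> ` carrier G)) \<phi>"
    using inj by (auto simp: homeomorphic_map_def quotient_map_def)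
  ultimately show "homeomorphic_map T (subtopology U (\<phi> ` carrier G)) \<phi>"
    by (simp add: T)
qed

text \<open>The unit is an open point, so it contains a basic neighbourhood of itself, and that
  neighbourhood is the kernel of evaluation at a stage.\<close>

lemma shape_group_discrete_stage:
  assumes k: "1 \<le> k" and S: "HPol_system S" and disc: "shape_group_discrete k S"
  obtains i where "i \<in> Idx S"
    "\<And>F. F \<in> shape_mor k S \<Longrightarrow> F i = \<one>\<^bsub>homotopy_group k (Obj S i)\<^esub> \<Longrightarrow> F = \<one>\<^bsub>shape_group k S\<^esub>"
proof -
  interpret group "shape_group k S"
    using k S by (rule group_shape_group)
  have one: "\<one>\<^bsub>shape_group k S\<^esub> \<in> shape_mor k S"
    using one_closed by (simp add: shape_group_simps)
  then have "openin (shape_topology k S) {\<one>\<^bsub>shape_group k S\<^esub>}"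
    using disc by (simp add: shape_group_discrete_def)
  then obtain i where "i \<in> Idx S" "shape_nbhd k S i \<one>\<^bsub>shape_group k S\<^esub> \<subseteq> {\<one>\<^bsub>shape_group k S\<^esub>}"
    unfolding openin_shape_topology[OF S] by blast
  then show ?thesis
    by (intro that[of i]) (auto simp: shape_nbhd_def shape_group_simps)
qed

text \<open>\<open>T\<close> computes the shape group of \<open>X\<close>, \<open>S\<close> is the
  expansion whose index is sought, and \<open>R\<close> computes the shape group of the stage found.
  The index \<open>l\<close> is fixed before \<open>R\<close> and serves every choice of it.\<close>

theorem discrete_shape_group_embeds:
  fixes X :: "'u ptd" and S :: "('i, 'u) inv_system" and T :: "('j, 'u) inv_system"
  assumes k: "1 \<le> k" and S: "HPol_expansion X S p" and T: "HPol_expansion X T q"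
    and disc: "shape_group_discrete k T"
  obtains l where "l \<in> Idx S"
    "\<And>(R :: ('l, 'u) inv_system) r. HPol_expansion (Obj S l) R r \<Longrightarrow>
       top_group_embeds (shape_group k T) (shape_topology k T) (shape_group k R) (shape_topology k R)"
proof -
  note expT = HPol_expansionD[OF T] and expS = HPol_expansionD[OF S]
  note sysT = HPol_systemD[OF expT(1)] and sysS = HPol_systemD[OF expS(1)]
  obtain j where j: "j \<in> Idx T"
    and ker: "\<And>F. F \<in> shape_mor k T \<Longrightarrow> F j = \<one>\<^bsub>homotopy_group k (Obj T j)\<^esub> \<Longrightarrow> F = \<one>\<^bsub>shape_group k T\<^esub>"
    using shape_group_discrete_stage[OF k expT(1) disc] by blast
  \<comment> \<open>(E1) for \<open>S\<close>, applied to \<open>q j\<close>, provides the index of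
    the theorem.\<close>
  obtain l g where l: "l \<in> Idx S" and g: "g \<in> hmor (Obj S l) (Obj T j)"
    and gp: "hcomp X (Obj T j) g (p l) = q j"
    using expS(4)[OF sysT(5)[OF j] expT(2)[OF j]] by blast
  \<comment> \<open>(E1) for \<open>T\<close>, applied to \<open>p l\<close>, lets the composite of
    \<open>p l\<close> with a shape morphism \<open>F\<close> be computed as \<open>u\<close> after
    \<open>F m\<close>.\<close>
  obtain m u where m: "m \<in> Idx T" and u: "u \<in> hmor (Obj T m) (Obj S l)"
    and uq: "hcomp X (Obj S l) u (q m) = p l"
    using expT(4)[OF sysS(5)[OF l] expS(2)[OF l]] by blast
  let ?P = "Obj S l"
  \<comment> \<open>So this composite determines \<open>F j\<close>: \<open>g\<close> after
    \<open>u\<close> at stage \<open>m\<close> and the identity at stage \<open>j\<close> both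
    represent \<open>q j\<close>.\<close>
  have guF: "hcomp (sph k) (Obj T j) g (hcomp (sph k) ?P u (F m)) = F j" if F: "F \<in> shape_mor k T" for F
  proof -
    have "hcomp X (Obj T j) (hcomp (Obj T m) (Obj T j) g u) (q m) = q j"
      using hcomp_assoc[OF expT(2)[OF m] u g] uq gp by simp
    also have "\<dots> = hcomp X (Obj T j) (hid (Obj T j)) (q j)"
      using expT(2)[OF j] by (simp add: hcomp_hid_left)
    finally have "hcomp (sph k) (Obj T j) (hcomp (Obj T m) (Obj T j) g u) (F m)
        = hcomp (sph k) (Obj T j) (hid (Obj T j)) (F j)"
      by (intro shape_mor_hcomp_cong[OF T sysT(5)[OF j] F m j] hcomp_in_hmor[OF u g] hid_in_hmor)
    then show ?thesis
      using hcomp_assoc[OF shape_morD(1)[OF F m] u g] hcomp_hid_left[OF shape_morD(1)[OF F j]] by simp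
  qed
  show ?thesis
  proof (rule that[OF l])
    fix R :: "('l, 'u) inv_system" and r
    assume R: "HPol_expansion ?P R r"
    note expR = HPol_expansionD[OF R]
    note sysR = HPol_systemD[OF expR(1)]
    \<comment> \<open>\<open>?P\<close> is polyhedral, hence a homotopy retract of a stage of
      \<open>R\<close>; \<open>v\<close> recovers \<open>u\<close> after \<open>F m\<close> from
      \<open>\<phi> F n\<close>.\<close>
    obtain n v where n: "n \<in> Idx R" and v: "v \<in> hmor (Obj R n) ?P" and retr: "hcomp ?P ?P v (r n) = hid ?P"
      using HPol_expansion_retraction[OF R sysS(5)[OF l]] by blast
    \<comment> \<open>The composite of \<open>F\<close> with \<open>p l\<close> as a shape morphism
      into \<open>?P\<close>, written out at the stages of \<open>R\<close>.\<close>
    define \<phi> where "\<phi> F = (\<lambda>i\<in>Idx R. hcomp (sph k) (Obj R i) (hcomp (Obj T m) (Obj R i) (r i) u) (F m))" for F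
    have ru: "hcomp (Obj T m) (Obj R i) (r i) u \<in> hmor (Obj T m) (Obj R i)" if "i \<in> Idx R" for i
      using hcomp_in_hmor[OF u expR(2)[OF that]] .
    interpret T: group "shape_group k T"
      using k expT(1) by (rule group_shape_group)
    interpret R: group "shape_group k R"
      using k expR(1) by (rule group_shape_group)
    interpret Tj: group "homotopy_group k (Obj T j)"
      using k j sysT(5) by (intro group_homotopy_group HPol_imp_ptd_space)
    have \<phi>_mor: "\<phi> F \<in> shape_mor k R" if F: "F \<in> shape_mor k T" for F
    proof -
      have "hcomp (sph k) (Obj R i) (hcomp (Obj T m) (Obj R i) (r i) u) (F m) \<in> hmor (sph k) (Obj R i)"
        if "i \<in> Idx R" for i
        using hcomp_in_hmor[OF shape_morD(1)[OF F m] ru[OF that]] .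
      moreover have "hcomp (sph k) (Obj R i) (Bond R i h)
            (hcomp (sph k) (Obj R h) (hcomp (Obj T m) (Obj R h) (r h) u) (F m))
          = hcomp (sph k) (Obj R i) (hcomp (Obj T m) (Obj R i) (r i) u) (F m)"
        if "i \<in> Idx R" "h \<in> Idx R" "Leq R i h" for i h
        using that hcomp_assoc[OF shape_morD(1)[OF F m] ru[OF that(2)] sysR(6)[OF that]]
          hcomp_assoc[OF u expR(2)[OF that(2)] sysR(6)[OF that]] expR(3)[OF that] by simp
      ultimately show ?thesis
        by (auto simp: shape_mor_def \<phi>_def)
    qed
    have hom: "group_hom (shape_group k T) (shape_group k R) \<phi>"
    proof (rule group_hom.intro[OF T.is_group R.is_group], unfold group_hom_axioms_def, rule homI)
      show "\<phi> F \<in> carrier (shape_group k R)" if "F \<in> carrier (shape_group k T)" for F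
        using that \<phi>_mor by (simp add: shape_group_simps)
      fix F G assume FG: "F \<in> carrier (shape_group k T)" "G \<in> carrier (shape_group k T)"
      then have FG': "F \<in> shape_mor k T" "G \<in> shape_mor k T"
        by (simp_all add: shape_group_simps)
      show "\<phi> (F \<otimes>\<^bsub>shape_group k T\<^esub> G) = \<phi> F \<otimes>\<^bsub>shape_group k R\<^esub> \<phi> G"
      proof (rule shape_mor_eqI[of _ k R])
        show "\<phi> (F \<otimes>\<^bsub>shape_group k T\<^esub> G) \<in> shape_mor k R"
          using \<phi>_mor T.m_closed[OF FG] by (simp add: shape_group_simps)
        show "\<phi> F \<otimes>\<^bsub>shape_group k R\<^esub> \<phi> G \<in> shape_mor k R"
          using R.m_closed[of "\<phi> F" "\<phi> G"] \<phi>_mor FG' by (simp add: shape_group_simps)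
        show "\<phi> (F \<otimes>\<^bsub>shape_group k T\<^esub> G) i = (\<phi> F \<otimes>\<^bsub>shape_group k R\<^esub> \<phi> G) i" if "i \<in> Idx R" for i
          using hom_mult[OF hcomp_hom[OF k ru[OF that]], of "F m" "G m"] that m shape_morD(1)[OF _ m] FG'
          by (simp add: shape_group_simps \<phi>_def homotopy_group_def)
      qed
    qed
    \<comment> \<open>If \<open>\<phi> F\<close> is trivial, applying \<open>v\<close> at stage
      \<open>n\<close> shows that \<open>F\<close> and the unit agree after \<open>u\<close>, hence
      by \<open>guF\<close> at stage \<open>j\<close>, where the kernel is trivial.\<close>
    have "F = \<one>\<^bsub>shape_group k T\<^esub>" if F: "F \<in> shape_mor k T" and "\<phi> F = \<one>\<^bsub>shape_group k R\<^esub>" for F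
    proof -
      note hom_one = group_hom.hom_one[OF hom]
      have one: "\<one>\<^bsub>shape_group k T\<^esub> \<in> shape_mor k T"
        using T.one_closed by (simp add: shape_group_simps)
      have "hcomp (sph k) ?P v (\<phi> G n) = hcomp (sph k) ?P u (G m)" if G: "G \<in> shape_mor k T" for G
      proof -
        note Gm = shape_morD(1)[OF G m]
        have uG: "hcomp (sph k) ?P u (G m) \<in> hmor (sph k) ?P"
          using hcomp_in_hmor[OF Gm u] .
        have "\<phi> G n = hcomp (sph k) (Obj R n) (r n) (hcomp (sph k) ?P u (G m))"
          using n hcomp_assoc[OF Gm u expR(2)[OF n]] by (simp add: \<phi>_def)
        then show ?thesis
          using hcomp_assoc[OF uG expR(2)[OF n] v] retr hcomp_hid_left[OF uG] by simp
      qed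
      then have "hcomp (sph k) ?P u (F m) = hcomp (sph k) ?P u (\<one>\<^bsub>shape_group k T\<^esub> m)"
        using F one that(2) hom_one by metis
      then have "F j = \<one>\<^bsub>shape_group k T\<^esub> j"
        using guF[OF F] guF[OF one] by simp
      then show ?thesis
        using ker[OF F] j by (simp add: shape_group_simps)
    qed
    then have "inj_on \<phi> (carrier (shape_group k T))"
      using group_hom.inj_on_one_iff[OF hom] by (simp add: shape_group_simps)
    moreover have "shape_group_discrete k R"
      using HPol_shape_group_discrete[OF sysS(5)[OF l] R] .
    ultimately show "top_group_embeds (shape_group k T) (shape_topology k T) (shape_group k R) (shape_topology k R)"
      using top_group_embeds_discrete[OF hom] disc by (simp add: shape_group_simps shape_group_discrete_def)
  qed
qed

theorem theorem4p4:
  fixes X :: "'u ptd" and k :: nat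
  assumes "ptd_space X" and "1 \<le> k"
  shows
    "(HPol X \<longrightarrow>
        (\<forall>(S :: ('i, 'u) inv_system) p. HPol_expansion X S p \<longrightarrow> shape_group_discrete k S)) \<and>
     (\<forall>(S :: ('i, 'u) inv_system) p (T :: ('j, 'u) inv_system) q.
        HPol_expansion X S p \<and> HPol_expansion X T q \<and> shape_group_discrete k T \<longrightarrow>
        (\<exists>l\<in>Idx S. \<forall>(R :: ('l, 'u) inv_system) r. HPol_expansion (Obj S l) R r \<longrightarrow>
            top_group_embeds (shape_group k T) (shape_topology k T)
                             (shape_group k R) (shape_topology k R)))"
proof (intro conjI impI allI)
  fix S :: "('i, 'u) inv_system" and p
  assume "HPol X" "HPol_expansion X S p"
  then show "shape_group_discrete k S"
    by (rule HPol_shape_group_discrete)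
next
  fix S :: "('i, 'u) inv_system" and p and T :: "('j, 'u) inv_system" and q
  assume "HPol_expansion X S p \<and> HPol_expansion X T q \<and> shape_group_discrete k T"
  then show "\<exists>l\<in>Idx S. \<forall>(R :: ('l, 'u) inv_system) r. HPol_expansion (Obj S l) R r \<longrightarrow>
      top_group_embeds (shape_group k T) (shape_topology k T) (shape_group k R) (shape_topology k R)"
    using discrete_shape_group_embeds[OF assms(2)] by metis
qed

end
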